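(* Let $(M_i,\Delta_{\diamond_i},\Delta_{\bullet_i},\alpha_{M_i})$, $i=1,2$, be two comodules over the comultiplicative post-Hom-Lie coalgebra $(L,\gamma,\Delta_\cdot,\alpha)$ and let $k\ge 0$ be an integer. Define $\alpha_M=\alpha_{M_1}\otimes\alpha_{M_2}:M_1\otimes M_2\to M_1\otimes M_2$ and linear maps $\Delta_\diamond,\Delta_\bullet:M_1\otimes M_2\to L\otimes M_1\otimes M_2$ by $$\Delta_\diamond=\big((\alpha^k\otimes \mathrm{Id}_{M_1})\circ\Delta_{\diamond_1}\big)\otimes\alpha_{M_2}+(\tau\otimes \mathrm{Id}_{M_2})\circ\big(\alpha_{M_1}\otimes((\alpha^k\otimes \mathrm{Id}_{M_2})\circ\Delta_{\diamond_2})\big),$$ $$\Delta_\bullet=\big((\alpha^k\otimes \mathrm{Id}_{M_1})\circ\Delta_{\bullet_1}\big)\otimes\alpha_{M_2}+(\tau\otimes \mathrm{Id}_{M_2})\circ\big(\alpha_{M_1}\otimes((\alpha^k\otimes \mathrm{Id}_{M_2})\circ\Delta_{\bullet_2})\big),$$ where $\tau:M_1\otimes L\to L\otimes M_1$ is the flip. Then $(M_1\otimes M_2,\Delta_\diamond,\Delta_\bullet,\alpha_M)$ is a comodule over $L$.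
   Context: All vector spaces are over a field $\mathbb{F}$ of characteristic $0$; $I$ is the identity map, $\tau(x\otimes y)=y\otimes x$, $\xi(x\otimes y\otimes z)=y\otimes z\otimes x$, $\xi^2(x\otimes y\otimes z)=z\otimes x\otimes y$. A post-Hom-Lie coalgebra $(L,\gamma,\Delta_\cdot,\alpha)$ is a vector space $L$ with linear maps $\gamma,\Delta_\cdot:L\to L\otimes L$ and $\alpha:L\to L$ such that (i) $\gamma=-\tau\circ\gamma$ and $\gamma\circ\alpha=(\alpha\otimes\alpha)\circ\gamma$; (ii) $(1+\xi+\xi^2)\circ(\alpha\otimes\gamma)\circ\gamma=0$; (iii) $(\alpha\otimes\gamma)\circ\Delta_\cdot-(\Delta_\cdot\otimes\alpha)\circ\gamma-(\tau\otimes I)\circ(\alpha\otimes\Delta_\cdot)\circ\gamma=0$; (iv) $(\Delta_\cdot\otimes\alpha)\circ\Delta_\cdot-(\alpha\otimes\Delta_\cdot)\circ\Delta_\cdot-(\tau\otimes I)\circ(\Delta_\cdot\otimes\alpha)\circ\Delta_\cdot+(\tau\otimes I)\circ(\alpha\otimes\Delta_\cdot)\circ\Delta_\cdot+(\gamma\otimes\alpha)\circ\Delta_\cdot=0$. It is comultiplicative if moreover $\Delta_\cdot\circ\alpha=(\alpha\otimes\alpha)\circ\Delta_\cdot$. A comodule over $L$ is a tuple $(M,\Delta_\diamond,\Delta_\bullet,\alpha_M)$ with $M$ a vector space, $\alpha_M:M\to M$ linear, and linear maps $\Delta_\diamond,\Delta_\bullet:M\to L\otimes M$ such that (a) $\Delta_\diamond\circ\alpha_M=(\alpha\otimes\alpha_M)\circ\Delta_\diamond$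 and $\Delta_\bullet\circ\alpha_M=(\alpha\otimes\alpha_M)\circ\Delta_\bullet$; (b) $(\gamma\otimes\alpha_M)\circ\Delta_\diamond=(\alpha\otimes\Delta_\diamond)\circ\Delta_\diamond-(\tau\otimes \mathrm{Id}_M)\circ(\alpha\otimes\Delta_\diamond)\circ\Delta_\diamond$; (c) $(\Delta_\cdot\otimes\alpha_M)\circ\Delta_\diamond=(\alpha\otimes\Delta_\diamond)\circ\Delta_\bullet-(\tau\otimes \mathrm{Id}_M)\circ(\alpha\otimes\Delta_\bullet)\circ\Delta_\diamond$; (d) $(\gamma\otimes\alpha_M)\circ\Delta_\bullet=(1-\tau\otimes \mathrm{Id}_M)\circ(\alpha\otimes\Delta_\bullet)\circ\Delta_\bullet+(\tau\otimes \mathrm{Id}_M-1)\circ(\Delta_\cdot\otimes\alpha_M)\circ\Delta_\bullet$. *)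

theory Defs
  imports "Jordan_Normal_Form.Missing_VectorSpace" "HOL-Algebra.AbelCoset"
begin

section \<open>Tensor products of vector spaces\<close>

text \<open>
  Vector spaces are \<^locale>\<open>vectorspace\<close> records over a field record \<open>K\<close>. The tensor product is
  the free vector space on \<open>carrier V \<times> carrier W\<close> modulo the bilinearity relations. The fields
  \<open>mult\<close> and \<open>one\<close> of a module record carry no meaning.
\<close>

definition free_space :: "('k, 'r) ring_scheme \<Rightarrow> 's set \<Rightarrow> ('k, 's \<Rightarrow> 'k) module"
  where "free_space K S = (ring.func_space K S)
    \<lparr>carrier := {f \<in> S \<rightarrow>\<^sub>E carrier K. finite {x \<in> S. f x \<noteq> \<zero>\<^bsub>K\<^esub>}}\<rparr>"

definition free_gen :: "('k, 'r) ring_scheme \<Rightarrow> 's set \<Rightarrow> 's \<Rightarrow> 's \<Rightarrow> 'k"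
  where "free_gen K S x = (\<lambda>y\<in>S. if y = x then \<one>\<^bsub>K\<^esub> else \<zero>\<^bsub>K\<^esub>)"

text \<open>
  Adding \<open>N\<close> in the scalar multiplication matters only for the scalar zero, where
  \<open>{c \<odot> x | x \<in> X}\<close> is not a full coset.
\<close>

definition quot_space :: "('k, 'v, 'e) module_scheme \<Rightarrow> 'v set \<Rightarrow> ('k, 'v set) module"
  where "quot_space V N = \<lparr>carrier = a_rcosets\<^bsub>V\<^esub> N, mult = undefined, one = undefined,
    zero = N, add = (\<lambda>X Y. X <+>\<^bsub>V\<^esub> Y),
    smult = (\<lambda>c X. N <+>\<^bsub>V\<^esub> ((\<lambda>x. c \<odot>\<^bsub>V\<^esub> x) ` X))\<rparr>"

definition tensor_relations ::
    "('k, 'r) ring_scheme \<Rightarrow> ('k, 'v, 'e) module_scheme \<Rightarrow> ('k, 'w, 'f) module_scheme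
      \<Rightarrow> ('v \<times> 'w \<Rightarrow> 'k) set"
  where "tensor_relations K V W =
    (let F = free_space K (carrier V \<times> carrier W);
         e = (\<lambda>v w. free_gen K (carrier V \<times> carrier W) (v, w))
     in {e (v \<oplus>\<^bsub>V\<^esub> v') w \<ominus>\<^bsub>F\<^esub> (e v w \<oplus>\<^bsub>F\<^esub> e v' w) | v v' w.
            v \<in> carrier V \<and> v' \<in> carrier V \<and> w \<in> carrier W}
      \<union> {e v (w \<oplus>\<^bsub>W\<^esub> w') \<ominus>\<^bsub>F\<^esub> (e v w \<oplus>\<^bsub>F\<^esub> e v w') | v w w'.
            v \<in> carrier V \<and> w \<in> carrier W \<and> w' \<in> carrier W}
      \<union> {e (c \<odot>\<^bsub>V\<^esub> v) w \<ominus>\<^bsub>F\<^esub> (c \<odot>\<^bsub>F\<^esub> e v w) | c v w.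
            c \<in> carrier K \<and> v \<in> carrier V \<and> w \<in> carrier W}
      \<union> {e v (c \<odot>\<^bsub>W\<^esub> w) \<ominus>\<^bsub>F\<^esub> (c \<odot>\<^bsub>F\<^esub> e v w) | c v w.
            c \<in> carrier K \<and> v \<in> carrier V \<and> w \<in> carrier W})"

definition tensor_null ::
    "('k, 'r) ring_scheme \<Rightarrow> ('k, 'v, 'e) module_scheme \<Rightarrow> ('k, 'w, 'f) module_scheme
      \<Rightarrow> ('v \<times> 'w \<Rightarrow> 'k) set"
  where "tensor_null K V W =
    LinearCombinations.module.span K (free_space K (carrier V \<times> carrier W))
      (tensor_relations K V W)"

definition tensor_space ::
    "('k, 'r) ring_scheme \<Rightarrow> ('k, 'v, 'e) module_scheme \<Rightarrow> ('k, 'w, 'f) module_scheme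
      \<Rightarrow> ('k, ('v \<times> 'w \<Rightarrow> 'k) set) module"  (infixr \<open>\<boxtimes>\<index>\<close> 80)
  where "V \<boxtimes>\<^bsub>K\<^esub> W = quot_space (free_space K (carrier V \<times> carrier W)) (tensor_null K V W)"

definition pure_tensor ::
    "('k, 'r) ring_scheme \<Rightarrow> ('k, 'v, 'e) module_scheme \<Rightarrow> ('k, 'w, 'f) module_scheme
      \<Rightarrow> 'v \<Rightarrow> 'w \<Rightarrow> ('v \<times> 'w \<Rightarrow> 'k) set"
  where "pure_tensor K V W v w =
    tensor_null K V W +>\<^bsub>free_space K (carrier V \<times> carrier W)\<^esub>
      free_gen K (carrier V \<times> carrier W) (v, w)"

text \<open>
  The linear map on \<open>V \<boxtimes> W\<close> with prescribed values on pure tensors; existence and uniqueness for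
  bilinear \<open>b\<close> are shown below (\<open>tensor_lift_ex1\<close>).
\<close>

definition tensor_lift ::
    "('k, 'r) ring_scheme \<Rightarrow> ('k, 'v, 'e) module_scheme \<Rightarrow> ('k, 'w, 'f) module_scheme
      \<Rightarrow> ('k, 'z, 'g) module_scheme \<Rightarrow> ('v \<Rightarrow> 'w \<Rightarrow> 'z) \<Rightarrow> ('v \<times> 'w \<Rightarrow> 'k) set \<Rightarrow> 'z"
  where "tensor_lift K V W Z b = (THE T. linear_map K (V \<boxtimes>\<^bsub>K\<^esub> W) Z T
    \<and> T \<in> extensional (carrier (V \<boxtimes>\<^bsub>K\<^esub> W))
    \<and> (\<forall>v\<in>carrier V. \<forall>w\<in>carrier W. T (pure_tensor K V W v w) = b v w))"

subsection \<open>The universal property\<close>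

lemma free_space_vectorspace:
  assumes K: "field K"
  shows "vectorspace K (free_space K S)"
proof -
  interpret field K by fact
  interpret F: module K "func_space S" by (rule func_space_is_module)
  let ?C = "{f \<in> S \<rightarrow>\<^sub>E carrier K. finite {x \<in> S. f x \<noteq> \<zero>\<^bsub>K\<^esub>}}"
  have sub: "LinearCombinations.submodule K ?C (func_space S)"
  proof (unfold_locales, goal_cases)
    case 1 then show ?case by (auto simp: func_space_def)
  next
    case (2 v w)
    have "{x \<in> S. v x \<oplus>\<^bsub>K\<^esub> w x \<noteq> \<zero>\<^bsub>K\<^esub>} \<subseteq> {x \<in> S. v x \<noteq> \<zero>\<^bsub>K\<^esub>} \<union> {x \<in> S. w x \<noteq> \<zero>\<^bsub>K\<^esub>}"
      by auto
    with 2 have "finite {x \<in> S. v x \<oplus>\<^bsub>K\<^esub> w x \<noteq> \<zero>\<^bsub>K\<^esub>}"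
      by (auto intro: finite_subset)
    moreover have "{x \<in> S. (if x \<in> S then v x \<oplus>\<^bsub>K\<^esub> w x else undefined) \<noteq> \<zero>\<^bsub>K\<^esub>} = {x \<in> S. v x \<oplus>\<^bsub>K\<^esub> w x \<noteq> \<zero>\<^bsub>K\<^esub>}" by auto
    ultimately show ?case using 2 by (auto simp: func_space_def restrict_def intro!: a_closed dest: PiE_mem)
  next
    case 3
    have "{x \<in> S. (if x \<in> S then \<zero>\<^bsub>K\<^esub> else undefined) \<noteq> \<zero>\<^bsub>K\<^esub>} = {}" by auto
    then show ?case by (auto simp: func_space_def restrict_def)
  next
    case (4 c v)
    have "{x \<in> S. (if x \<in> S then c \<otimes>\<^bsub>K\<^esub> v x else undefined) \<noteq> \<zero>\<^bsub>K\<^esub>} \<subseteq> {x \<in> S. v x \<noteq> \<zero>\<^bsub>K\<^esub>}"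
      using 4 by auto
    then have "finite {x \<in> S. (if x \<in> S then c \<otimes>\<^bsub>K\<^esub> v x else undefined) \<noteq> \<zero>\<^bsub>K\<^esub>}"
      by (rule finite_subset) (use 4 in simp)
    then show ?case using 4 by (auto simp: func_space_def restrict_def intro!: m_closed dest: PiE_mem)
  qed
  have "module K (free_space K S)"
    using F.submodule_is_module[OF sub] by (simp add: free_space_def)
  then show ?thesis by (simp add: vectorspace_def field_axioms)
qed

lemma quot_space_module:
  assumes V: "module K V" and N: "LinearCombinations.submodule K N V"
  shows "module K (quot_space V N)" (is ?mod)
    and "mod_hom K V (quot_space V N) (\<lambda>x. N +>\<^bsub>V\<^esub> x)" (is ?hom)
    and "x \<in> carrier V \<Longrightarrow> y \<in> carrier V \<Longrightarrow>
      (N +>\<^bsub>V\<^esub> x = N +>\<^bsub>V\<^esub> y) = (x \<ominus>\<^bsub>V\<^esub> y \<in> N)"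
proof -
  interpret module K V by fact
  interpret N: LinearCombinations.submodule K N V by fact
  have inv: "\<ominus>\<^bsub>V\<^esub> x \<in> N" if "x \<in> N" for x
    using N.smult_closed[OF R.a_inv_closed[OF R.one_closed] that] smult_minus_1[of x] that N.subset
    by (metis subsetD)
  have sg: "subgroup N (add_monoid V)"
    by (rule subgroup.intro) (use N.subset inv in \<open>auto simp: a_inv_def[symmetric]\<close>)
  interpret A: abelian_subgroup N V
    by (rule abelian_subgroupI3) (auto intro: additive_subgroupI sg M.abelian_group_axioms)
  have rep: "\<exists>x\<in>carrier V. X = N +>\<^bsub>V\<^esub> x" if "X \<in> a_rcosets\<^bsub>V\<^esub> N" for X
    using that by (auto simp: A_RCOSETS_def')
  have cos: "N +>\<^bsub>V\<^esub> x \<in> a_rcosets\<^bsub>V\<^esub> N" if "x \<in> carrier V" for x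
    using that by (auto simp: A_RCOSETS_def')
  have N0: "N = N +>\<^bsub>V\<^esub> \<zero>\<^bsub>V\<^esub>" using N.subset by simp
  have sm: "N <+>\<^bsub>V\<^esub> ((\<lambda>x. c \<odot>\<^bsub>V\<^esub> x) ` (N +>\<^bsub>V\<^esub> x)) = N +>\<^bsub>V\<^esub> (c \<odot>\<^bsub>V\<^esub> x)"
    if c: "c \<in> carrier K" and x: "x \<in> carrier V" for c x
  proof (intro equalityI subsetI)
    fix y assume "y \<in> N <+>\<^bsub>V\<^esub> ((\<lambda>x. c \<odot>\<^bsub>V\<^esub> x) ` (N +>\<^bsub>V\<^esub> x))"
    then obtain n n' where n: "n \<in> N" "n' \<in> N" and y: "y = n \<oplus>\<^bsub>V\<^esub> c \<odot>\<^bsub>V\<^esub> (n' \<oplus>\<^bsub>V\<^esub> x)"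
      by (auto simp: set_add_def' a_r_coset_def')
    have "y = (n \<oplus>\<^bsub>V\<^esub> c \<odot>\<^bsub>V\<^esub> n') \<oplus>\<^bsub>V\<^esub> c \<odot>\<^bsub>V\<^esub> x"
      using n c x N.subset unfolding y by (subst smult_r_distr) (auto simp: M.a_assoc subset_iff)
    then show "y \<in> N +>\<^bsub>V\<^esub> (c \<odot>\<^bsub>V\<^esub> x)" using n c by (auto simp: a_r_coset_def')
  next
    fix y assume "y \<in> N +>\<^bsub>V\<^esub> (c \<odot>\<^bsub>V\<^esub> x)"
    then obtain n where n: "n \<in> N" and y: "y = n \<oplus>\<^bsub>V\<^esub> c \<odot>\<^bsub>V\<^esub> x" by (auto simp: a_r_coset_def')
    have "x \<in> N +>\<^bsub>V\<^esub> x" by (rule A.a_rcos_self[OF x])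
    then show "y \<in> N <+>\<^bsub>V\<^esub> ((\<lambda>x. c \<odot>\<^bsub>V\<^esub> x) ` (N +>\<^bsub>V\<^esub> x))"
      using n unfolding y by (auto simp: set_add_def')
  qed
  show ?mod
  proof (rule module_criteria, unfold simp_thms quot_space_def module.simps ring.simps partial_object.simps monoid.simps, goal_cases)
    case 1 show ?case by (rule is_cring)
  next case 2 show ?case by (rule A.a_subgroup_in_rcosets)
  next case 3 show ?case by (auto dest!: rep simp: A.a_rcos_sum cos)
  next case 4 show ?case
    proof
      fix X assume "X \<in> a_rcosets\<^bsub>V\<^esub> N"
      then obtain x where "x \<in> carrier V" "X = N +>\<^bsub>V\<^esub> x" using rep by blast
      then show "\<exists>Y\<in>a_rcosets\<^bsub>V\<^esub> N. X <+>\<^bsub>V\<^esub> Y = N"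
        by (intro bexI[of _ "N +>\<^bsub>V\<^esub> (\<ominus>\<^bsub>V\<^esub> x)"]) (auto simp: A.a_rcos_sum cos M.r_neg N0[symmetric])
    qed
  next case 5 show ?case by (auto dest!: rep simp: sm cos)
  next case 6 show ?case by (auto dest!: rep simp: A.a_rcos_sum M.a_comm)
  next case 7 show ?case by (auto dest!: rep simp: A.a_rcos_sum M.a_assoc)
  next case 8 show ?case
    proof
      fix X assume "X \<in> a_rcosets\<^bsub>V\<^esub> N"
      then obtain x where x: "x \<in> carrier V" "X = N +>\<^bsub>V\<^esub> x" using rep by blast
      have "(N +>\<^bsub>V\<^esub> x) <+>\<^bsub>V\<^esub> (N +>\<^bsub>V\<^esub> \<zero>\<^bsub>V\<^esub>) = N +>\<^bsub>V\<^esub> x" using x by (simp add: A.a_rcos_sum del: M.a_coset_add_zero)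
      then show "X <+>\<^bsub>V\<^esub> N = X" using x N0 by simp
    qed
  next case 9 show ?case by (auto dest!: rep simp: sm smult_assoc1)
  next case 10 show ?case by (auto dest!: rep simp: sm)
  next case 11 show ?case by (auto dest!: rep simp: sm A.a_rcos_sum smult_l_distr)
  next case 12 show ?case by (auto dest!: rep simp: sm A.a_rcos_sum smult_r_distr)
  qed
  then show ?hom
    by (intro mod_hom.intro mod_hom_axioms.intro module_axioms)
      (auto simp: module_hom_def quot_space_def sm cos A.a_rcos_sum)
  assume x: "x \<in> carrier V" and y: "y \<in> carrier V"
  show "(N +>\<^bsub>V\<^esub> x = N +>\<^bsub>V\<^esub> y) = (x \<ominus>\<^bsub>V\<^esub> y \<in> N)"
  proof
    assume "N +>\<^bsub>V\<^esub> x = N +>\<^bsub>V\<^esub> y"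
    then have "x \<in> N +>\<^bsub>V\<^esub> y" using A.a_rcos_self[OF x] by simp
    then obtain n where "n \<in> N" "x = n \<oplus>\<^bsub>V\<^esub> y" by (auto simp: a_r_coset_def')
    then show "x \<ominus>\<^bsub>V\<^esub> y \<in> N" using y N.subset
      by (auto simp: a_minus_def M.a_assoc M.r_neg subset_iff)
  next
    assume n: "x \<ominus>\<^bsub>V\<^esub> y \<in> N"
    have "x = (x \<ominus>\<^bsub>V\<^esub> y) \<oplus>\<^bsub>V\<^esub> y" using x y by (simp add: a_minus_def M.a_assoc M.l_neg)
    then have "x \<in> N +>\<^bsub>V\<^esub> y" using n unfolding a_r_coset_def' by blast
    then show "N +>\<^bsub>V\<^esub> x = N +>\<^bsub>V\<^esub> y" using a_repr_independence[OF _ y sg] by simp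
  qed
qed


lemma free_space_simps:
  assumes "field K"
  shows "carrier (free_space K S) = {f \<in> S \<rightarrow>\<^sub>E carrier K. finite {x \<in> S. f x \<noteq> \<zero>\<^bsub>K\<^esub>}}"
    and "f \<oplus>\<^bsub>free_space K S\<^esub> g = (\<lambda>x\<in>S. f x \<oplus>\<^bsub>K\<^esub> g x)"
    and "c \<odot>\<^bsub>free_space K S\<^esub> f = (\<lambda>x\<in>S. c \<otimes>\<^bsub>K\<^esub> f x)"
    and "\<zero>\<^bsub>free_space K S\<^esub> = (\<lambda>x\<in>S. \<zero>\<^bsub>K\<^esub>)"
proof -
  interpret field K by fact
  show "carrier (free_space K S) = {f \<in> S \<rightarrow>\<^sub>E carrier K. finite {x \<in> S. f x \<noteq> \<zero>\<^bsub>K\<^esub>}}"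
    and "f \<oplus>\<^bsub>free_space K S\<^esub> g = (\<lambda>x\<in>S. f x \<oplus>\<^bsub>K\<^esub> g x)"
    and "c \<odot>\<^bsub>free_space K S\<^esub> f = (\<lambda>x\<in>S. c \<otimes>\<^bsub>K\<^esub> f x)"
    and "\<zero>\<^bsub>free_space K S\<^esub> = (\<lambda>x\<in>S. \<zero>\<^bsub>K\<^esub>)"
    by (simp_all add: free_space_def func_space_def)
qed

lemma free_gen_closed:
  assumes "field K" "x \<in> S"
  shows "free_gen K S x \<in> carrier (free_space K S)"
proof -
  interpret field K by fact
  have "{y \<in> S. free_gen K S x y \<noteq> \<zero>\<^bsub>K\<^esub>} \<subseteq> {x}" by (auto simp: free_gen_def)
  then have "finite {y \<in> S. free_gen K S x y \<noteq> \<zero>\<^bsub>K\<^esub>}" by (rule finite_subset) simp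
  then show ?thesis by (auto simp: free_space_simps[OF assms(1)] free_gen_def)
qed

lemma free_space_induct:
  assumes K: "field K" and f: "f \<in> carrier (free_space K S)"
    and zero: "P \<zero>\<^bsub>free_space K S\<^esub>"
    and step: "\<And>f c x. f \<in> carrier (free_space K S) \<Longrightarrow> P f \<Longrightarrow> c \<in> carrier K \<Longrightarrow> x \<in> S \<Longrightarrow>
      P (f \<oplus>\<^bsub>free_space K S\<^esub> (c \<odot>\<^bsub>free_space K S\<^esub> free_gen K S x))"
  shows "P f"
proof -
  interpret field K by fact
  have "\<forall>f \<in> carrier (free_space K S). {x \<in> S. f x \<noteq> \<zero>\<^bsub>K\<^esub>} = A \<longrightarrow> P f" if "finite A" for A
    using that
  proof (induction A rule: finite_induct)
    case empty
    show ?case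
    proof (intro ballI impI)
      fix f assume "f \<in> carrier (free_space K S)" "{x \<in> S. f x \<noteq> \<zero>\<^bsub>K\<^esub>} = {}"
      then have "f = \<zero>\<^bsub>free_space K S\<^esub>"
        by (auto simp: free_space_simps[OF K] PiE_def extensional_def)
      with zero show "P f" by simp
    qed
  next
    case (insert a A)
    show ?case
    proof (intro ballI impI)
      fix f assume f: "f \<in> carrier (free_space K S)" and s: "{x \<in> S. f x \<noteq> \<zero>\<^bsub>K\<^esub>} = insert a A"
      have a: "a \<in> S" "f a \<in> carrier K" using s f by (auto simp: free_space_simps[OF K])
      define g where "g = (\<lambda>x\<in>S. if x = a then \<zero>\<^bsub>K\<^esub> else f x)"
      have gs: "{x \<in> S. g x \<noteq> \<zero>\<^bsub>K\<^esub>} = A" using s insert by (auto simp: g_def)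
      have g: "g \<in> carrier (free_space K S)" 
      proof -
        have "g \<in> S \<rightarrow>\<^sub>E carrier K" using f by (auto simp: free_space_simps[OF K] g_def)
        then show ?thesis using gs insert by (simp add: free_space_simps[OF K])
      qed
      have "f x = (g \<oplus>\<^bsub>free_space K S\<^esub> (f a \<odot>\<^bsub>free_space K S\<^esub> free_gen K S a)) x" for x
      proof (cases "x \<in> S")
        case True
        then have "f x \<in> carrier K" using f by (auto simp: free_space_simps(1)[OF K])
        with True a show ?thesis by (simp add: free_space_simps(2,3)[OF K] free_gen_def g_def)
      next
        case False
        then have "f x = undefined" using f by (auto simp: free_space_simps(1)[OF K])
        with False show ?thesis by (simp add: free_space_simps(2)[OF K])
      qed
      then have eq: "f = g \<oplus>\<^bsub>free_space K S\<^esub> (f a \<odot>\<^bsub>free_space K S\<^esub> free_gen K S a)" by (rule ext)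
      have "P g" using insert.IH g gs by blast
      then show "P f" by (subst eq) (rule step[OF g _ a(2,1)])
    qed
  qed
  with f show ?thesis by (auto simp: free_space_simps(1)[OF K])
qed

lemma free_space_lift:
  assumes Z: "vectorspace K Z" and b: "b \<in> S \<rightarrow> carrier Z"
  obtains \<phi> where "mod_hom K (free_space K S) Z \<phi>" "\<And>x. x \<in> S \<Longrightarrow> \<phi> (free_gen K S x) = b x"
proof -
  interpret Z: vectorspace K Z by fact
  have K: "field K" by unfold_locales
  interpret F: vectorspace K "free_space K S" by (rule free_space_vectorspace[OF K])
  define \<phi> where "\<phi> f = (\<Oplus>\<^bsub>Z\<^esub>x\<in>{x \<in> S. f x \<noteq> \<zero>\<^bsub>K\<^esub>}. f x \<odot>\<^bsub>Z\<^esub> b x)" for f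
  have bZ: "b x \<in> carrier Z" if "x \<in> S" for x using b that by auto
  have fK: "f x \<in> carrier K" if "f \<in> carrier (free_space K S)" "x \<in> S" for f x
    using that by (auto simp: free_space_simps[OF K])
  have ext: "\<phi> f = (\<Oplus>\<^bsub>Z\<^esub>x\<in>A. f x \<odot>\<^bsub>Z\<^esub> b x)"
    if "finite A" "A \<subseteq> S" "{x \<in> S. f x \<noteq> \<zero>\<^bsub>K\<^esub>} \<subseteq> A" "f \<in> carrier (free_space K S)" for f A
    unfolding \<phi>_def
    by (rule Z.M.add.finprod_mono_neutral_cong_left) (use that bZ fK in \<open>auto simp: subset_iff\<close>)
  have add: "\<phi> (f \<oplus>\<^bsub>free_space K S\<^esub> g) = \<phi> f \<oplus>\<^bsub>Z\<^esub> \<phi> g"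
    if f: "f \<in> carrier (free_space K S)" and g: "g \<in> carrier (free_space K S)" for f g
  proof -
    let ?h = "f \<oplus>\<^bsub>free_space K S\<^esub> g"
    let ?A = "{x \<in> S. f x \<noteq> \<zero>\<^bsub>K\<^esub>} \<union> {x \<in> S. g x \<noteq> \<zero>\<^bsub>K\<^esub>}"
    have A: "finite ?A" "?A \<subseteq> S" using f g by (auto simp: free_space_simps[OF K])
    have h: "?h \<in> carrier (free_space K S)" using f g by (rule F.M.a_closed)
    have "\<phi> ?h = (\<Oplus>\<^bsub>Z\<^esub>x\<in>?A. ?h x \<odot>\<^bsub>Z\<^esub> b x)"
      by (rule ext) (use A h in \<open>auto simp: free_space_simps[OF K]\<close>)
    also have "\<dots> = (\<Oplus>\<^bsub>Z\<^esub>x\<in>?A. f x \<odot>\<^bsub>Z\<^esub> b x \<oplus>\<^bsub>Z\<^esub> g x \<odot>\<^bsub>Z\<^esub> b x)"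
      by (rule Z.M.finsum_cong') (use f g fK bZ in \<open>auto simp: free_space_simps(2)[OF K] Z.smult_l_distr\<close>)
    also have "\<dots> = (\<Oplus>\<^bsub>Z\<^esub>x\<in>?A. f x \<odot>\<^bsub>Z\<^esub> b x) \<oplus>\<^bsub>Z\<^esub> (\<Oplus>\<^bsub>Z\<^esub>x\<in>?A. g x \<odot>\<^bsub>Z\<^esub> b x)"
      by (rule Z.M.finsum_addf) (use f g fK bZ in auto)
    also have "\<dots> = \<phi> f \<oplus>\<^bsub>Z\<^esub> \<phi> g" using A f g by (subst (1 2) ext[of ?A]) auto
    finally show ?thesis .
  qed
  have smult: "\<phi> (c \<odot>\<^bsub>free_space K S\<^esub> f) = c \<odot>\<^bsub>Z\<^esub> \<phi> f"
    if c: "c \<in> carrier K" and f: "f \<in> carrier (free_space K S)" for c f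
  proof -
    let ?A = "{x \<in> S. f x \<noteq> \<zero>\<^bsub>K\<^esub>}"
    have A: "finite ?A" using f by (auto simp: free_space_simps[OF K])
    have "\<phi> (c \<odot>\<^bsub>free_space K S\<^esub> f) = (\<Oplus>\<^bsub>Z\<^esub>x\<in>?A. (c \<odot>\<^bsub>free_space K S\<^esub> f) x \<odot>\<^bsub>Z\<^esub> b x)"
      by (rule ext) (use A c F.smult_closed[OF c f] in \<open>auto simp: free_space_simps(3)[OF K]\<close>)
    also have "\<dots> = (\<Oplus>\<^bsub>Z\<^esub>x\<in>?A. c \<odot>\<^bsub>Z\<^esub> (f x \<odot>\<^bsub>Z\<^esub> b x))"
      by (rule Z.M.finsum_cong') (use c f fK bZ in \<open>auto simp: free_space_simps(3)[OF K] Z.smult_assoc1\<close>)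
    also have "\<dots> = c \<odot>\<^bsub>Z\<^esub> \<phi> f" unfolding \<phi>_def
      by (rule Z.finsum_smult_ldistr[symmetric]) (use A c f fK bZ in auto)
    finally show ?thesis .
  qed
  have "\<phi> \<in> module_hom K (free_space K S) Z"
    using add smult by (auto simp: module_hom_def \<phi>_def fK bZ intro!: Z.M.finsum_closed)
  then have hom: "mod_hom K (free_space K S) Z \<phi>"
    by (intro mod_hom.intro mod_hom_axioms.intro F.module_axioms Z.module_axioms)
  have "\<phi> (free_gen K S x) = b x" if x: "x \<in> S" for x
  proof -
    have "\<phi> (free_gen K S x) = (\<Oplus>\<^bsub>Z\<^esub>y\<in>{x}. free_gen K S x y \<odot>\<^bsub>Z\<^esub> b y)"
      by (rule ext) (use x free_gen_closed[OF K x] in \<open>auto simp: free_gen_def\<close>)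
    then show ?thesis using x bZ by (simp add: free_gen_def)
  qed
  with hom that show thesis by blast
qed

lemma tensor_relations_closed:
  assumes V: "vectorspace K V" and W: "vectorspace K W"
  shows "tensor_relations K V W \<subseteq> carrier (free_space K (carrier V \<times> carrier W))"
proof -
  interpret V: vectorspace K V by fact
  interpret W: vectorspace K W by fact
  have K: "field K" by unfold_locales
  interpret F: vectorspace K "free_space K (carrier V \<times> carrier W)"
    by (rule free_space_vectorspace[OF K])
  show ?thesis
    by (auto simp: tensor_relations_def Let_def intro!: F.M.minus_closed F.M.a_closed F.smult_closed free_gen_closed[OF K])
qed

lemma tensor_null_submodule:
  assumes V: "vectorspace K V" and W: "vectorspace K W"
  shows "LinearCombinations.submodule K (tensor_null K V W) (free_space K (carrier V \<times> carrier W))"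
proof -
  interpret V: vectorspace K V by fact
  have K: "field K" by unfold_locales
  interpret F: vectorspace K "free_space K (carrier V \<times> carrier W)"
    by (rule free_space_vectorspace[OF K])
  show ?thesis unfolding tensor_null_def
    by (rule F.span_is_submodule[OF tensor_relations_closed[OF V W]])
qed

lemma tensor_space_vectorspace:
  assumes V: "vectorspace K V" and W: "vectorspace K W"
  shows "vectorspace K (V \<boxtimes>\<^bsub>K\<^esub> W)"
proof -
  interpret V: vectorspace K V by fact
  have K: "field K" by unfold_locales
  interpret F: vectorspace K "free_space K (carrier V \<times> carrier W)"
    by (rule free_space_vectorspace[OF K])
  show ?thesis unfolding tensor_space_def vectorspace_def
    using quot_space_module(1)[OF F.module_axioms tensor_null_submodule[OF V W]] K by blast
qed

definition bilinear_map ::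
    "('k, 'r) ring_scheme \<Rightarrow> ('k, 'v, 'e) module_scheme \<Rightarrow> ('k, 'w, 'f) module_scheme
      \<Rightarrow> ('k, 'z, 'g) module_scheme \<Rightarrow> ('v \<Rightarrow> 'w \<Rightarrow> 'z) \<Rightarrow> bool"
  where "bilinear_map K V W Z b \<longleftrightarrow>
    (\<forall>v\<in>carrier V. b v \<in> module_hom K W Z) \<and> (\<forall>w\<in>carrier W. (\<lambda>v. b v w) \<in> module_hom K V Z)"

lemma pure_tensor_bilinear:
  assumes V: "vectorspace K V" and W: "vectorspace K W"
  shows "bilinear_map K V W (V \<boxtimes>\<^bsub>K\<^esub> W) (pure_tensor K V W)"
proof -
  interpret V: vectorspace K V by fact
  interpret W: vectorspace K W by fact
  have K: "field K" by unfold_locales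
  let ?F = "free_space K (carrier V \<times> carrier W)"
  let ?e = "\<lambda>v w. free_gen K (carrier V \<times> carrier W) (v, w)"
  interpret F: vectorspace K ?F by (rule free_space_vectorspace[OF K])
  note N = tensor_null_submodule[OF V W]
  interpret q: mod_hom K ?F "V \<boxtimes>\<^bsub>K\<^esub> W" "\<lambda>x. tensor_null K V W +>\<^bsub>?F\<^esub> x"
    unfolding tensor_space_def by (rule quot_space_module(2)[OF F.module_axioms N])
  note eq = quot_space_module(3)[OF F.module_axioms N]
  have rel: "x \<in> tensor_null K V W" if "x \<in> tensor_relations K V W" for x
    using F.in_own_span[OF tensor_relations_closed[OF V W]] that by (auto simp: tensor_null_def)
  have e: "?e v w \<in> carrier ?F" if "v \<in> carrier V" "w \<in> carrier W" for v w
    by (rule free_gen_closed[OF K]) (use that in auto)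
  have 1: "pure_tensor K V W (v \<oplus>\<^bsub>V\<^esub> v') w = pure_tensor K V W v w \<oplus>\<^bsub>V \<boxtimes>\<^bsub>K\<^esub> W\<^esub> pure_tensor K V W v' w"
    if "v \<in> carrier V" "v' \<in> carrier V" "w \<in> carrier W" for v v' w
  proof -
    have "?e (v \<oplus>\<^bsub>V\<^esub> v') w \<ominus>\<^bsub>?F\<^esub> (?e v w \<oplus>\<^bsub>?F\<^esub> ?e v' w) \<in> tensor_relations K V W"
      unfolding tensor_relations_def Let_def using that by blast
    from rel[OF this] show ?thesis unfolding pure_tensor_def
      using that by (simp add: e eq[symmetric])
  qed
  have 2: "pure_tensor K V W v (w \<oplus>\<^bsub>W\<^esub> w') = pure_tensor K V W v w \<oplus>\<^bsub>V \<boxtimes>\<^bsub>K\<^esub> W\<^esub> pure_tensor K V W v w'"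
    if "v \<in> carrier V" "w' \<in> carrier W" "w \<in> carrier W" for v w w'
  proof -
    have "?e v (w \<oplus>\<^bsub>W\<^esub> w') \<ominus>\<^bsub>?F\<^esub> (?e v w \<oplus>\<^bsub>?F\<^esub> ?e v w') \<in> tensor_relations K V W"
      unfolding tensor_relations_def Let_def using that by blast
    from rel[OF this] show ?thesis unfolding pure_tensor_def
      using that by (simp add: e eq[symmetric])
  qed
  have 3: "pure_tensor K V W (c \<odot>\<^bsub>V\<^esub> v) w = c \<odot>\<^bsub>V \<boxtimes>\<^bsub>K\<^esub> W\<^esub> pure_tensor K V W v w"
    if "c \<in> carrier K" "v \<in> carrier V" "w \<in> carrier W" for c v w
  proof -
    have "?e (c \<odot>\<^bsub>V\<^esub> v) w \<ominus>\<^bsub>?F\<^esub> (c \<odot>\<^bsub>?F\<^esub> ?e v w) \<in> tensor_relations K V W"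
      unfolding tensor_relations_def Let_def using that by blast
    from rel[OF this] show ?thesis unfolding pure_tensor_def
      using that by (simp add: e eq[symmetric])
  qed
  have 4: "pure_tensor K V W v (c \<odot>\<^bsub>W\<^esub> w) = c \<odot>\<^bsub>V \<boxtimes>\<^bsub>K\<^esub> W\<^esub> pure_tensor K V W v w"
    if "c \<in> carrier K" "v \<in> carrier V" "w \<in> carrier W" for c v w
  proof -
    have "?e v (c \<odot>\<^bsub>W\<^esub> w) \<ominus>\<^bsub>?F\<^esub> (c \<odot>\<^bsub>?F\<^esub> ?e v w) \<in> tensor_relations K V W"
      unfolding tensor_relations_def Let_def using that by blast
    from rel[OF this] show ?thesis unfolding pure_tensor_def
      using that by (simp add: e eq[symmetric])
  qed
  have "pure_tensor K V W v w \<in> carrier (V \<boxtimes>\<^bsub>K\<^esub> W)" if "v \<in> carrier V" "w \<in> carrier W" for v w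
    unfolding pure_tensor_def by (rule q.f_im) (rule e[OF that])
  with 1 2 3 4 show ?thesis by (auto simp: bilinear_map_def module_hom_def)
qed

lemma tensor_lift_ex1:
  assumes V: "vectorspace K V" and W: "vectorspace K W" and Z: "vectorspace K Z"
    and b: "bilinear_map K V W Z b"
  shows "\<exists>!T. linear_map K (V \<boxtimes>\<^bsub>K\<^esub> W) Z T \<and> T \<in> extensional (carrier (V \<boxtimes>\<^bsub>K\<^esub> W))
    \<and> (\<forall>v\<in>carrier V. \<forall>w\<in>carrier W. T (pure_tensor K V W v w) = b v w)"
proof -
  interpret V: vectorspace K V by fact
  interpret W: vectorspace K W by fact
  interpret Z: vectorspace K Z by fact
  have K: "field K" by unfold_locales
  let ?F = "free_space K (carrier V \<times> carrier W)"
  let ?e = "\<lambda>v w. free_gen K (carrier V \<times> carrier W) (v, w)"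
  let ?q = "\<lambda>x. tensor_null K V W +>\<^bsub>?F\<^esub> x"
  interpret F: vectorspace K ?F by (rule free_space_vectorspace[OF K])
  interpret T: vectorspace K "V \<boxtimes>\<^bsub>K\<^esub> W" by (rule tensor_space_vectorspace[OF V W])
  note N = tensor_null_submodule[OF V W]
  interpret q: mod_hom K ?F "V \<boxtimes>\<^bsub>K\<^esub> W" ?q
    unfolding tensor_space_def by (rule quot_space_module(2)[OF F.module_axioms N])
  note eq = quot_space_module(3)[OF F.module_axioms N]
  have e: "?e v w \<in> carrier ?F" if "v \<in> carrier V" "w \<in> carrier W" for v w
    by (rule free_gen_closed[OF K]) (use that in auto)
  have carr: "\<exists>f\<in>carrier ?F. X = ?q f" if "X \<in> carrier (V \<boxtimes>\<^bsub>K\<^esub> W)" for X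
    using that by (auto simp: tensor_space_def quot_space_def A_RCOSETS_def')
  have bc: "b v w \<in> carrier Z" if "v \<in> carrier V" "w \<in> carrier W" for v w
    using b that by (auto simp: bilinear_map_def module_hom_def)
  obtain \<phi> where \<phi>: "mod_hom K ?F Z \<phi>"
    and \<phi>e: "\<And>x. x \<in> carrier V \<times> carrier W \<Longrightarrow> \<phi> (free_gen K (carrier V \<times> carrier W) x) = case_prod b x"
    by (rule free_space_lift[OF Z, of "case_prod b" "carrier V \<times> carrier W"]) (use bc in auto)
  interpret \<phi>: mod_hom K ?F Z \<phi> by (rule \<phi>)
  have \<phi>0: "\<phi> x = \<zero>\<^bsub>Z\<^esub>" if "x \<in> tensor_null K V W" for x
  proof -
    have m: "\<phi> (x \<ominus>\<^bsub>?F\<^esub> y) = \<zero>\<^bsub>Z\<^esub>" if "x \<in> carrier ?F" "y \<in> carrier ?F" "\<phi> x = \<phi> y" for x y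
      using that by (simp add: \<phi>.f_minus a_minus_def \<phi>.f_neg Z.M.r_neg)
    have bl: "b (v \<oplus>\<^bsub>V\<^esub> v') w = b v w \<oplus>\<^bsub>Z\<^esub> b v' w" "b v (w \<oplus>\<^bsub>W\<^esub> w') = b v w \<oplus>\<^bsub>Z\<^esub> b v w'"
      "b (c \<odot>\<^bsub>V\<^esub> v) w = c \<odot>\<^bsub>Z\<^esub> b v w" "b v (c \<odot>\<^bsub>W\<^esub> w) = c \<odot>\<^bsub>Z\<^esub> b v w"
      if "c \<in> carrier K" "v \<in> carrier V" "v' \<in> carrier V" "w \<in> carrier W" "w' \<in> carrier W" for c v v' w w'
      using b that by (auto simp: bilinear_map_def module_hom_def)
    have "tensor_relations K V W \<subseteq> \<phi>.ker"
      unfolding tensor_relations_def Let_def \<phi>.ker_def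
      apply (intro Un_least subsetI CollectI)
         apply (elim CollectE exE conjE; hypsubst; intro conjI m F.M.minus_closed F.M.a_closed F.smult_closed e V.M.a_closed W.M.a_closed V.smult_closed W.smult_closed; (assumption | simp add: e \<phi>e bl[OF V.R.one_closed] bl(3,4)[OF _ _ V.M.zero_closed _ W.M.zero_closed]))+
      done
    then have "tensor_null K V W \<subseteq> \<phi>.ker"
      unfolding tensor_null_def by (rule F.span_is_subset) (rule \<phi>.ker_is_submodule)
    with that show ?thesis by (auto simp: \<phi>.ker_def)
  qed
  define T where "T = (\<lambda>X\<in>carrier (V \<boxtimes>\<^bsub>K\<^esub> W). \<phi> (SOME f. f \<in> carrier ?F \<and> X = ?q f))"
  have T_ext: "T \<in> extensional (carrier (V \<boxtimes>\<^bsub>K\<^esub> W))" by (simp add: T_def)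
  have Tq: "T (?q f) = \<phi> f" if f: "f \<in> carrier ?F" for f
  proof -
    define g where "g = (SOME g. g \<in> carrier ?F \<and> ?q f = ?q g)"
    have g: "g \<in> carrier ?F" "?q f = ?q g"
      using someI[of "\<lambda>g. g \<in> carrier ?F \<and> ?q f = ?q g" f] f by (auto simp: g_def)
    have "T (?q f) = \<phi> g" using q.f_im[OF f] by (simp add: T_def g_def)
    moreover have "\<phi> f \<ominus>\<^bsub>Z\<^esub> \<phi> g = \<zero>\<^bsub>Z\<^esub>"
      using \<phi>0[of "f \<ominus>\<^bsub>?F\<^esub> g"] g f by (simp add: eq \<phi>.f_minus a_minus_def \<phi>.f_neg)
    ultimately show ?thesis using f g by simp
  qed
  have hom: "T \<in> module_hom K (V \<boxtimes>\<^bsub>K\<^esub> W) Z"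
    unfolding module_hom_def
    by (auto dest!: carr simp: Tq q.f_add[symmetric] q.f_smult[symmetric] simp del: q.f_add q.f_smult)
  have lin: "linear_map K (V \<boxtimes>\<^bsub>K\<^esub> W) Z T"
    by (intro linear_map.intro mod_hom.intro mod_hom_axioms.intro hom T.vectorspace_axioms
        Z.vectorspace_axioms T.module_axioms Z.module_axioms)
  show ?thesis
  proof (rule ex1I[of _ T])
    show "linear_map K (V \<boxtimes>\<^bsub>K\<^esub> W) Z T \<and> T \<in> extensional (carrier (V \<boxtimes>\<^bsub>K\<^esub> W))
      \<and> (\<forall>v\<in>carrier V. \<forall>w\<in>carrier W. T (pure_tensor K V W v w) = b v w)"
      using lin T_ext by (auto simp: pure_tensor_def Tq e \<phi>e)
  next
    fix T' assume T': "linear_map K (V \<boxtimes>\<^bsub>K\<^esub> W) Z T' \<and> T' \<in> extensional (carrier (V \<boxtimes>\<^bsub>K\<^esub> W))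
      \<and> (\<forall>v\<in>carrier V. \<forall>w\<in>carrier W. T' (pure_tensor K V W v w) = b v w)"
    then interpret T': linear_map K "V \<boxtimes>\<^bsub>K\<^esub> W" Z T' by blast
    have "T' (?q f) = \<phi> f" if "f \<in> carrier ?F" for f
    proof (rule free_space_induct[OF K that])
      show "T' (?q \<zero>\<^bsub>?F\<^esub>) = \<phi> \<zero>\<^bsub>?F\<^esub>" by simp
    next
      fix f c x
      assume f: "f \<in> carrier ?F" "T' (?q f) = \<phi> f" and c: "c \<in> carrier K"
        and "x \<in> carrier V \<times> carrier W"
      then obtain v w where x: "x = (v, w)" "v \<in> carrier V" "w \<in> carrier W" by auto
      have "T' (?q (?e v w)) = b v w" using T' x by (auto simp: pure_tensor_def)
      then show "T' (?q (f \<oplus>\<^bsub>?F\<^esub> (c \<odot>\<^bsub>?F\<^esub> free_gen K (carrier V \<times> carrier W) x)))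
        = \<phi> (f \<oplus>\<^bsub>?F\<^esub> (c \<odot>\<^bsub>?F\<^esub> free_gen K (carrier V \<times> carrier W) x))"
        using f c x by (simp add: e \<phi>e)
    qed
    then show "T' = T"
      by (intro extensionalityI[of _ "carrier (V \<boxtimes>\<^bsub>K\<^esub> W)"])
        (use T' T_ext in \<open>auto dest!: carr simp: Tq\<close>)
  qed
qed

subsection \<open>Maps between tensor products\<close>

text \<open>\<open>tensor_map K V V' W W' f g\<close> is \<open>f \<otimes> g : V \<otimes> W \<rightarrow> V' \<otimes> W'\<close> for \<open>f : V \<rightarrow> V'\<close>, \<open>g : W \<rightarrow> W'\<close>.\<close>

definition tensor_map ::
    "('k, 'r) ring_scheme \<Rightarrow> ('k, 'v, 'e) module_scheme \<Rightarrow> ('k, 'v1, 'e1) module_scheme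
      \<Rightarrow> ('k, 'w, 'f) module_scheme \<Rightarrow> ('k, 'w1, 'f1) module_scheme
      \<Rightarrow> ('v \<Rightarrow> 'v1) \<Rightarrow> ('w \<Rightarrow> 'w1) \<Rightarrow> ('v \<times> 'w \<Rightarrow> 'k) set \<Rightarrow> ('v1 \<times> 'w1 \<Rightarrow> 'k) set"
  where "tensor_map K V V' W W' f g =
    tensor_lift K V W (V' \<boxtimes>\<^bsub>K\<^esub> W') (\<lambda>v w. pure_tensor K V' W' (f v) (g w))"

definition tensor_flip ::
    "('k, 'r) ring_scheme \<Rightarrow> ('k, 'v, 'e) module_scheme \<Rightarrow> ('k, 'w, 'f) module_scheme
      \<Rightarrow> ('v \<times> 'w \<Rightarrow> 'k) set \<Rightarrow> ('w \<times> 'v \<Rightarrow> 'k) set"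
  where "tensor_flip K V W = tensor_lift K V W (W \<boxtimes>\<^bsub>K\<^esub> V) (\<lambda>v w. pure_tensor K W V w v)"

text \<open>
  Triple tensor products are kept in the right-nested form \<open>U \<boxtimes> (V \<boxtimes> W)\<close>; the identification with
  \<open>(U \<boxtimes> V) \<boxtimes> W\<close>, tacit on paper, is made explicit.
\<close>

definition tensor_assoc_right ::
    "('k, 'r) ring_scheme \<Rightarrow> ('k, 'u, 'd) module_scheme \<Rightarrow> ('k, 'v, 'e) module_scheme
      \<Rightarrow> ('k, 'w, 'f) module_scheme
      \<Rightarrow> (('u \<times> 'v \<Rightarrow> 'k) set \<times> 'w \<Rightarrow> 'k) set \<Rightarrow> ('u \<times> ('v \<times> 'w \<Rightarrow> 'k) set \<Rightarrow> 'k) set"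
  where "tensor_assoc_right K U V W =
    tensor_lift K (U \<boxtimes>\<^bsub>K\<^esub> V) W (U \<boxtimes>\<^bsub>K\<^esub> V \<boxtimes>\<^bsub>K\<^esub> W)
      (\<lambda>t w. tensor_lift K U V (U \<boxtimes>\<^bsub>K\<^esub> V \<boxtimes>\<^bsub>K\<^esub> W)
        (\<lambda>u v. pure_tensor K U (V \<boxtimes>\<^bsub>K\<^esub> W) u (pure_tensor K V W v w)) t)"

definition tensor_assoc_left ::
    "('k, 'r) ring_scheme \<Rightarrow> ('k, 'u, 'd) module_scheme \<Rightarrow> ('k, 'v, 'e) module_scheme
      \<Rightarrow> ('k, 'w, 'f) module_scheme
      \<Rightarrow> ('u \<times> ('v \<times> 'w \<Rightarrow> 'k) set \<Rightarrow> 'k) set \<Rightarrow> (('u \<times> 'v \<Rightarrow> 'k) set \<times> 'w \<Rightarrow> 'k) set"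
  where "tensor_assoc_left K U V W =
    tensor_lift K U (V \<boxtimes>\<^bsub>K\<^esub> W) ((U \<boxtimes>\<^bsub>K\<^esub> V) \<boxtimes>\<^bsub>K\<^esub> W)
      (\<lambda>u t. tensor_lift K V W ((U \<boxtimes>\<^bsub>K\<^esub> V) \<boxtimes>\<^bsub>K\<^esub> W)
        (\<lambda>v w. pure_tensor K (U \<boxtimes>\<^bsub>K\<^esub> V) W (pure_tensor K U V u v) w) t)"

text \<open>\<open>\<tau> \<otimes> Id\<close>, as a map \<open>U \<otimes> V \<otimes> W \<rightarrow> V \<otimes> U \<otimes> W\<close>.\<close>

definition tensor_flip_id ::
    "('k, 'r) ring_scheme \<Rightarrow> ('k, 'u, 'd) module_scheme \<Rightarrow> ('k, 'v, 'e) module_scheme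
      \<Rightarrow> ('k, 'w, 'f) module_scheme
      \<Rightarrow> ('u \<times> ('v \<times> 'w \<Rightarrow> 'k) set \<Rightarrow> 'k) set \<Rightarrow> ('v \<times> ('u \<times> 'w \<Rightarrow> 'k) set \<Rightarrow> 'k) set"
  where "tensor_flip_id K U V W =
    tensor_assoc_right K V U W
      \<circ> tensor_map K (U \<boxtimes>\<^bsub>K\<^esub> V) (V \<boxtimes>\<^bsub>K\<^esub> U) W W (tensor_flip K U V) id
      \<circ> tensor_assoc_left K U V W"

text \<open>\<open>\<xi> (x \<otimes> y \<otimes> z) = y \<otimes> z \<otimes> x\<close>.\<close>

definition tensor_cycle ::
    "('k, 'r) ring_scheme \<Rightarrow> ('k, 'v, 'e) module_scheme
      \<Rightarrow> ('v \<times> ('v \<times> 'v \<Rightarrow> 'k) set \<Rightarrow> 'k) set \<Rightarrow> ('v \<times> ('v \<times> 'v \<Rightarrow> 'k) set \<Rightarrow> 'k) set"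
  where "tensor_cycle K V =
    tensor_lift K V (V \<boxtimes>\<^bsub>K\<^esub> V) (V \<boxtimes>\<^bsub>K\<^esub> V \<boxtimes>\<^bsub>K\<^esub> V)
      (\<lambda>x t. tensor_lift K V V (V \<boxtimes>\<^bsub>K\<^esub> V \<boxtimes>\<^bsub>K\<^esub> V)
        (\<lambda>y z. pure_tensor K V (V \<boxtimes>\<^bsub>K\<^esub> V) y (pure_tensor K V V z x)) t)"

section \<open>Post-Hom-Lie coalgebras and their comodules\<close>

locale field_char_zero = field K for K (structure) +
  assumes char_zero: "n > 0 \<Longrightarrow> [(n::nat)] \<cdot> \<one> \<noteq> \<zero>"

text \<open>\<open>\<Delta>\<close> stands for \<open>\<Delta>\<^sub>\<cdot>\<close>.\<close>

locale post_hom_lie_coalgebra = field_char_zero K + L: vectorspace K L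
  for K (structure) and L and \<gamma> and \<Delta> and \<alpha> +
  assumes gamma_linear: "linear_map K L (L \<boxtimes> L) \<gamma>"
    and Delta_linear: "linear_map K L (L \<boxtimes> L) \<Delta>"
    and alpha_linear: "linear_map K L L \<alpha>"
    and gamma_skew: "x \<in> carrier L \<Longrightarrow> \<gamma> x = \<ominus>\<^bsub>L \<boxtimes> L\<^esub> (tensor_flip K L L \<circ> \<gamma>) x"
    and gamma_alpha: "x \<in> carrier L \<Longrightarrow> (\<gamma> \<circ> \<alpha>) x = (tensor_map K L L L L \<alpha> \<alpha> \<circ> \<gamma>) x"
    and gamma_jacobi: "x \<in> carrier L \<Longrightarrow>
      (let t = (tensor_map K L L L (L \<boxtimes> L) \<alpha> \<gamma> \<circ> \<gamma>) x
       in t \<oplus>\<^bsub>L \<boxtimes> L \<boxtimes> L\<^esub> tensor_cycle K L t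
            \<oplus>\<^bsub>L \<boxtimes> L \<boxtimes> L\<^esub> (tensor_cycle K L \<circ> tensor_cycle K L) t) = \<zero>\<^bsub>L \<boxtimes> L \<boxtimes> L\<^esub>"
    and Delta_gamma: "x \<in> carrier L \<Longrightarrow>
      (tensor_map K L L L (L \<boxtimes> L) \<alpha> \<gamma> \<circ> \<Delta>) x
      \<ominus>\<^bsub>L \<boxtimes> L \<boxtimes> L\<^esub> (tensor_assoc_right K L L L \<circ> tensor_map K L (L \<boxtimes> L) L L \<Delta> \<alpha> \<circ> \<gamma>) x
      \<ominus>\<^bsub>L \<boxtimes> L \<boxtimes> L\<^esub> (tensor_flip_id K L L L \<circ> tensor_map K L L L (L \<boxtimes> L) \<alpha> \<Delta> \<circ> \<gamma>) x
      = \<zero>\<^bsub>L \<boxtimes> L \<boxtimes> L\<^esub>"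
    and Delta_Delta: "x \<in> carrier L \<Longrightarrow>
      (tensor_assoc_right K L L L \<circ> tensor_map K L (L \<boxtimes> L) L L \<Delta> \<alpha> \<circ> \<Delta>) x
      \<ominus>\<^bsub>L \<boxtimes> L \<boxtimes> L\<^esub> (tensor_map K L L L (L \<boxtimes> L) \<alpha> \<Delta> \<circ> \<Delta>) x
      \<ominus>\<^bsub>L \<boxtimes> L \<boxtimes> L\<^esub> (tensor_flip_id K L L L \<circ> tensor_assoc_right K L L L
                        \<circ> tensor_map K L (L \<boxtimes> L) L L \<Delta> \<alpha> \<circ> \<Delta>) x
      \<oplus>\<^bsub>L \<boxtimes> L \<boxtimes> L\<^esub> (tensor_flip_id K L L L \<circ> tensor_map K L L L (L \<boxtimes> L) \<alpha> \<Delta> \<circ> \<Delta>) x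
      \<oplus>\<^bsub>L \<boxtimes> L \<boxtimes> L\<^esub> (tensor_assoc_right K L L L \<circ> tensor_map K L (L \<boxtimes> L) L L \<gamma> \<alpha> \<circ> \<Delta>) x
      = \<zero>\<^bsub>L \<boxtimes> L \<boxtimes> L\<^esub>"

locale comultiplicative_post_hom_lie_coalgebra = post_hom_lie_coalgebra +
  assumes Delta_alpha: "x \<in> carrier L \<Longrightarrow> (\<Delta> \<circ> \<alpha>) x = (tensor_map K L L L L \<alpha> \<alpha> \<circ> \<Delta>) x"

text \<open>\<open>D\<close>, \<open>B\<close> and \<open>\<alpha>M\<close> stand for \<open>\<Delta>\<^sub>\<diamond>\<close>, \<open>\<Delta>\<^sub>\<bullet>\<close> and \<open>\<alpha>\<^sub>M\<close>.\<close>

locale post_hom_lie_comodule = post_hom_lie_coalgebra K L \<gamma> \<Delta> \<alpha> + M: vectorspace K M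
  for K (structure) and L and \<gamma> and \<Delta> and \<alpha> and M and D and B and \<alpha>M +
  assumes alpha_M_linear: "linear_map K M M \<alpha>M"
    and D_linear: "linear_map K M (L \<boxtimes> M) D"
    and B_linear: "linear_map K M (L \<boxtimes> M) B"
    and D_alpha: "m \<in> carrier M \<Longrightarrow> (D \<circ> \<alpha>M) m = (tensor_map K L L M M \<alpha> \<alpha>M \<circ> D) m"
    and B_alpha: "m \<in> carrier M \<Longrightarrow> (B \<circ> \<alpha>M) m = (tensor_map K L L M M \<alpha> \<alpha>M \<circ> B) m"
    and gamma_D: "m \<in> carrier M \<Longrightarrow>
      (tensor_assoc_right K L L M \<circ> tensor_map K L (L \<boxtimes> L) M M \<gamma> \<alpha>M \<circ> D) m
      = (tensor_map K L L M (L \<boxtimes> M) \<alpha> D \<circ> D) m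
        \<ominus>\<^bsub>L \<boxtimes> L \<boxtimes> M\<^esub> (tensor_flip_id K L L M \<circ> tensor_map K L L M (L \<boxtimes> M) \<alpha> D \<circ> D) m"
    and Delta_D: "m \<in> carrier M \<Longrightarrow>
      (tensor_assoc_right K L L M \<circ> tensor_map K L (L \<boxtimes> L) M M \<Delta> \<alpha>M \<circ> D) m
      = (tensor_map K L L M (L \<boxtimes> M) \<alpha> D \<circ> B) m
        \<ominus>\<^bsub>L \<boxtimes> L \<boxtimes> M\<^esub> (tensor_flip_id K L L M \<circ> tensor_map K L L M (L \<boxtimes> M) \<alpha> B \<circ> D) m"
    and gamma_B: "m \<in> carrier M \<Longrightarrow>
      (tensor_assoc_right K L L M \<circ> tensor_map K L (L \<boxtimes> L) M M \<gamma> \<alpha>M \<circ> B) m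
      = (let t = (tensor_map K L L M (L \<boxtimes> M) \<alpha> B \<circ> B) m;
             s = (tensor_assoc_right K L L M \<circ> tensor_map K L (L \<boxtimes> L) M M \<Delta> \<alpha>M \<circ> B) m
         in (t \<ominus>\<^bsub>L \<boxtimes> L \<boxtimes> M\<^esub> tensor_flip_id K L L M t)
            \<oplus>\<^bsub>L \<boxtimes> L \<boxtimes> M\<^esub> (tensor_flip_id K L L M s \<ominus>\<^bsub>L \<boxtimes> L \<boxtimes> M\<^esub> s))"

text \<open>
  \<open>((\<alpha>\<^sup>k \<otimes> Id) \<circ> D\<^sub>1) \<otimes> \<alpha>\<^sub>2 + (\<tau> \<otimes> Id) \<circ> (\<alpha>\<^sub>1 \<otimes> ((\<alpha>\<^sup>k \<otimes> Id) \<circ> D\<^sub>2))\<close>, where \<open>D\<^sub>i : M\<^sub>i \<rightarrow> L \<otimes> M\<^sub>i\<close> and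
  \<open>\<alpha>\<^sub>i : M\<^sub>i \<rightarrow> M\<^sub>i\<close>.
\<close>

definition tensor_coaction ::
    "('k, 'r) ring_scheme \<Rightarrow> ('k, 'l, 'e) module_scheme \<Rightarrow> ('l \<Rightarrow> 'l) \<Rightarrow> nat
      \<Rightarrow> ('k, 'm, 'f) module_scheme \<Rightarrow> ('m \<Rightarrow> ('l \<times> 'm \<Rightarrow> 'k) set) \<Rightarrow> ('m \<Rightarrow> 'm)
      \<Rightarrow> ('k, 'n, 'g) module_scheme \<Rightarrow> ('n \<Rightarrow> ('l \<times> 'n \<Rightarrow> 'k) set) \<Rightarrow> ('n \<Rightarrow> 'n)
      \<Rightarrow> ('m \<times> 'n \<Rightarrow> 'k) set \<Rightarrow> ('l \<times> ('m \<times> 'n \<Rightarrow> 'k) set \<Rightarrow> 'k) set"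
  where "tensor_coaction K L \<alpha> k M1 D1 \<alpha>1 M2 D2 \<alpha>2 = (\<lambda>t.
    (tensor_assoc_right K L M1 M2
       \<circ> tensor_map K M1 (L \<boxtimes>\<^bsub>K\<^esub> M1) M2 M2 (tensor_map K L L M1 M1 (\<alpha> ^^ k) id \<circ> D1) \<alpha>2) t
    \<oplus>\<^bsub>L \<boxtimes>\<^bsub>K\<^esub> M1 \<boxtimes>\<^bsub>K\<^esub> M2\<^esub>
    (tensor_flip_id K M1 L M2
       \<circ> tensor_map K M1 M1 M2 (L \<boxtimes>\<^bsub>K\<^esub> M2) \<alpha>1 (tensor_map K L L M2 M2 (\<alpha> ^^ k) id \<circ> D2)) t)"

end

theory Submission
  imports Defs
begin

text \<open>
  On \<open>m \<otimes> n\<close> the tensor product coaction has one summand in which the coaction is applied to \<open>m\<close>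
  and one in which it is applied to \<open>n\<close>. A composite of two coactions therefore has two unmixed
  and two mixed terms. The unmixed ones are images, under maps commuting with \<open>\<tau> \<otimes> Id\<close>, of the
  corresponding composites over \<open>M\<^sub>1\<close> and \<open>M\<^sub>2\<close>; comultiplicativity lets \<open>\<alpha>\<^sup>k\<close> pass through \<open>\<gamma>\<close> and
  \<open>\<Delta>\<close>, so they satisfy the comodule identities. Each identity antisymmetrises a composite by
  \<open>\<tau> \<otimes> Id\<close>, which exchanges the mixed terms, and so these cancel.
\<close>

section \<open>Linear maps\<close>

text \<open>Elements of a tensor product are cosets of formal sums, so identities are proved by
  linearity from pure tensors. But \<open>D1 m\<close> and \<open>D2 n\<close> are not pure even
  when the argument is. Every composite is therefore written with maps that are linear in each
  tensor separately, and the lemmas vary one tensor at a time while the others stay arbitrary.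

  Condition (a) is what makes the mixed terms agree. In a composite of two coactions on
  \<open>m \<otimes> n\<close>, a mixed term applies one coaction to \<open>\<alpha>1 m\<close> or
  \<open>\<alpha>2 n\<close>, while the other coaction is followed by
  \<open>\<alpha> \<otimes> \<alpha>1\<close> or \<open>\<alpha> \<otimes> \<alpha>2\<close>.
  Composing in the opposite order exchanges these roles. Compatibility with \<open>\<alpha>\<close>
  turns both into the same expression, and only then does the flip match them.

  The computation is done once for arbitrary coactions X and Y. Taking X = Y = D gives (b), X = D
  and Y = B gives (c), and X = Y = B gives the first difference in (d). The terms in (d) that come
  from \<open>\<Delta>\<close> have no mixed part.\<close>

lemma linear_mapI:
  assumes "vectorspace K V" "vectorspace K W"
    and "\<And>x. x \<in> carrier V \<Longrightarrow> f x \<in> carrier W"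
    and "\<And>x y. x \<in> carrier V \<Longrightarrow> y \<in> carrier V \<Longrightarrow> f (x \<oplus>\<^bsub>V\<^esub> y) = f x \<oplus>\<^bsub>W\<^esub> f y"
    and "\<And>c x. c \<in> carrier K \<Longrightarrow> x \<in> carrier V \<Longrightarrow> f (c \<odot>\<^bsub>V\<^esub> x) = c \<odot>\<^bsub>W\<^esub> f x"
  shows "linear_map K V W f"
  using assms
  by (auto simp: linear_map_def mod_hom_def mod_hom_axioms_def module_hom_def vectorspace_def)

lemma linear_mapD:
  assumes "linear_map K V W f"
  shows "vectorspace K V" "vectorspace K W"
    and "x \<in> carrier V \<Longrightarrow> f x \<in> carrier W"
    and "x \<in> carrier V \<Longrightarrow> y \<in> carrier V \<Longrightarrow> f (x \<oplus>\<^bsub>V\<^esub> y) = f x \<oplus>\<^bsub>W\<^esub> f y"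
    and "x \<in> carrier V \<Longrightarrow> y \<in> carrier V \<Longrightarrow> f (x \<ominus>\<^bsub>V\<^esub> y) = f x \<ominus>\<^bsub>W\<^esub> f y"
    and "c \<in> carrier K \<Longrightarrow> x \<in> carrier V \<Longrightarrow> f (c \<odot>\<^bsub>V\<^esub> x) = c \<odot>\<^bsub>W\<^esub> f x"
    and "f \<zero>\<^bsub>V\<^esub> = \<zero>\<^bsub>W\<^esub>"
proof -
  interpret linear_map K V W f by fact
  show "vectorspace K V" "vectorspace K W" by unfold_locales
  show "x \<in> carrier V \<Longrightarrow> f x \<in> carrier W"
    and "x \<in> carrier V \<Longrightarrow> y \<in> carrier V \<Longrightarrow> f (x \<oplus>\<^bsub>V\<^esub> y) = f x \<oplus>\<^bsub>W\<^esub> f y"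
    and "x \<in> carrier V \<Longrightarrow> y \<in> carrier V \<Longrightarrow> f (x \<ominus>\<^bsub>V\<^esub> y) = f x \<ominus>\<^bsub>W\<^esub> f y"
    and "c \<in> carrier K \<Longrightarrow> x \<in> carrier V \<Longrightarrow> f (c \<odot>\<^bsub>V\<^esub> x) = c \<odot>\<^bsub>W\<^esub> f x"
    and "f \<zero>\<^bsub>V\<^esub> = \<zero>\<^bsub>W\<^esub>" by simp_all
qed

lemma linear_map_cong:
  assumes "linear_map K V W f" and "\<And>x. x \<in> carrier V \<Longrightarrow> g x = f x"
  shows "linear_map K V W g"
proof -
  interpret linear_map K V W f by fact
  show ?thesis
    by (rule linear_mapI) (simp_all add: assms(2) V.vectorspace_axioms W.vectorspace_axioms)
qed

lemma linear_map_id: "vectorspace K V \<Longrightarrow> linear_map K V V (\<lambda>x. x)"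
  by (rule linear_mapI) simp_all

lemma linear_map_compose:
  assumes "linear_map K V W g" and "linear_map K U V f"
  shows "linear_map K U W (\<lambda>x. g (f x))"
  by (rule linear_mapI) (simp_all add: linear_mapD[OF assms(1)] linear_mapD[OF assms(2)])

lemma linear_map_funpow:
  assumes "linear_map K V V f"
  shows "linear_map K V V (f ^^ n)"
proof (induction n)
  case 0
  show ?case using linear_map_id[OF linear_mapD(1)[OF assms]] by (simp add: id_def)
next
  case (Suc n)
  then show ?case using linear_map_compose[OF assms Suc] by (simp add: o_def)
qed

lemma linear_map_plus:
  assumes "linear_map K V W f" and "linear_map K V W g"
  shows "linear_map K V W (\<lambda>x. f x \<oplus>\<^bsub>W\<^esub> g x)"
proof -
  interpret W: vectorspace K W by (rule linear_mapD(2)[OF assms(1)])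
  show ?thesis
    by (rule linear_mapI)
      (auto simp: linear_mapD[OF assms(1)] linear_mapD[OF assms(2)] W.M.a_ac W.smult_r_distr)
qed

lemma linear_map_minus:
  assumes "linear_map K V W f" and "linear_map K V W g"
  shows "linear_map K V W (\<lambda>x. f x \<ominus>\<^bsub>W\<^esub> g x)"
proof -
  interpret W: vectorspace K W by (rule linear_mapD(2)[OF assms(1)])
  show ?thesis
    by (rule linear_mapI)
      (auto simp: linear_mapD[OF assms(1)] linear_mapD[OF assms(2)] a_minus_def W.M.minus_add
        W.M.a_ac W.smult_r_distr W.smult_r_minus)
qed

section \<open>Tensor calculus\<close>

lemma pure_tensor_closed:
  assumes "vectorspace K V" "vectorspace K W" "v \<in> carrier V" "w \<in> carrier W"
  shows "pure_tensor K V W v w \<in> carrier (V \<boxtimes>\<^bsub>K\<^esub> W)"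
  using pure_tensor_bilinear[OF assms(1,2)] assms(3,4) by (auto simp: bilinear_map_def module_hom_def)

lemma bilinear_mapI:
  assumes "\<And>v. v \<in> carrier V \<Longrightarrow> linear_map K W Z (b v)"
    and "\<And>w. w \<in> carrier W \<Longrightarrow> linear_map K V Z (\<lambda>v. b v w)"
  shows "bilinear_map K V W Z b"
  using assms by (auto simp: bilinear_map_def linear_map_def mod_hom_def mod_hom_axioms_def)

lemma bilinear_mapD:
  assumes "bilinear_map K V W Z b" "vectorspace K V" "vectorspace K W" "vectorspace K Z"
  shows "v \<in> carrier V \<Longrightarrow> linear_map K W Z (b v)"
    and "w \<in> carrier W \<Longrightarrow> linear_map K V Z (\<lambda>v. b v w)"
  using assms
  by (auto simp: bilinear_map_def linear_map_def mod_hom_def mod_hom_axioms_def vectorspace_def)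

lemma linear_map_pure_left:
  assumes "vectorspace K W" "w \<in> carrier W" "linear_map K U V f"
  shows "linear_map K U (V \<boxtimes>\<^bsub>K\<^esub> W) (\<lambda>x. pure_tensor K V W (f x) w)"
proof -
  note V = linear_mapD(2)[OF assms(3)]
  show ?thesis
    by (rule linear_map_compose[OF bilinear_mapD(2)[OF pure_tensor_bilinear[OF V assms(1)] V assms(1)
        tensor_space_vectorspace[OF V assms(1)] assms(2)] assms(3)])
qed

lemma linear_map_pure_right:
  assumes "vectorspace K V" "v \<in> carrier V" "linear_map K U W f"
  shows "linear_map K U (V \<boxtimes>\<^bsub>K\<^esub> W) (\<lambda>x. pure_tensor K V W v (f x))"
proof -
  note W = linear_mapD(2)[OF assms(3)]
  show ?thesis
    by (rule linear_map_compose[OF bilinear_mapD(1)[OF pure_tensor_bilinear[OF assms(1) W] assms(1) W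
        tensor_space_vectorspace[OF assms(1) W] assms(2)] assms(3)])
qed

lemma tensor_lift:
  assumes "vectorspace K V" "vectorspace K W" "vectorspace K Z" "bilinear_map K V W Z b"
  shows "linear_map K (V \<boxtimes>\<^bsub>K\<^esub> W) Z (tensor_lift K V W Z b)"
    and "v \<in> carrier V \<Longrightarrow> w \<in> carrier W \<Longrightarrow> tensor_lift K V W Z b (pure_tensor K V W v w) = b v w"
  using theI'[OF tensor_lift_ex1[OF assms]] by (auto simp: tensor_lift_def)

text \<open>This is the uniqueness half of the universal property: both maps lift the same bilinear
  map. It is the main proof principle for the identities that follow.\<close>

lemma tensor_ext:
  assumes f: "linear_map K (V \<boxtimes>\<^bsub>K\<^esub> W) Z f" and g: "linear_map K (V \<boxtimes>\<^bsub>K\<^esub> W) Z g"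
    and V: "vectorspace K V" and W: "vectorspace K W"
    and eq: "\<And>v w. v \<in> carrier V \<Longrightarrow> w \<in> carrier W \<Longrightarrow>
      f (pure_tensor K V W v w) = g (pure_tensor K V W v w)"
    and x: "x \<in> carrier (V \<boxtimes>\<^bsub>K\<^esub> W)"
  shows "f x = g x"
proof -
  let ?C = "carrier (V \<boxtimes>\<^bsub>K\<^esub> W)"
  note Z = linear_mapD(2)[OF f]
  let ?b = "\<lambda>v w. f (pure_tensor K V W v w)"
  have b: "bilinear_map K V W Z ?b"
    by (intro bilinear_mapI linear_map_compose[OF f] linear_map_pure_left linear_map_pure_right
        linear_map_id V W)
  \<comment> \<open>Uniqueness holds among extensional maps only, so the comparison is made after
    restriction to the carrier.\<close>
  have "restrict h ?C = tensor_lift K V W Z ?b"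
    if h: "linear_map K (V \<boxtimes>\<^bsub>K\<^esub> W) Z h"
      and "\<And>v w. v \<in> carrier V \<Longrightarrow> w \<in> carrier W \<Longrightarrow>
        h (pure_tensor K V W v w) = f (pure_tensor K V W v w)" for h
  proof -
    have "linear_map K (V \<boxtimes>\<^bsub>K\<^esub> W) Z (restrict h ?C)" by (rule linear_map_cong[OF h]) simp
    then show ?thesis unfolding tensor_lift_def
      by (intro the1_equality[OF tensor_lift_ex1[OF V W Z b], symmetric] conjI ballI)
        (simp_all add: that pure_tensor_closed V W)
  qed
  from this[OF f] this[OF g] have "restrict f ?C = restrict g ?C" by (simp add: eq)
  from fun_cong[OF this, of x] show ?thesis using x by simp
qed

text \<open>For properties that are not equations between two linear maps, such as linear dependence
  on a parameter, where \<open>tensor_ext\<close> does not apply.\<close>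

lemma tensor_induct [consumes 3, case_names pure zero add]:
  assumes V: "vectorspace K V" and W: "vectorspace K W" and x: "x \<in> carrier (V \<boxtimes>\<^bsub>K\<^esub> W)"
    and pure: "\<And>v w. v \<in> carrier V \<Longrightarrow> w \<in> carrier W \<Longrightarrow> P (pure_tensor K V W v w)"
    and zero: "P \<zero>\<^bsub>V \<boxtimes>\<^bsub>K\<^esub> W\<^esub>"
    and add: "\<And>x y. x \<in> carrier (V \<boxtimes>\<^bsub>K\<^esub> W) \<Longrightarrow> y \<in> carrier (V \<boxtimes>\<^bsub>K\<^esub> W) \<Longrightarrow> P x \<Longrightarrow> P y \<Longrightarrow>
      P (x \<oplus>\<^bsub>V \<boxtimes>\<^bsub>K\<^esub> W\<^esub> y)"
  shows "P x"
proof -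
  interpret V: vectorspace K V by fact
  have K: "field K" by unfold_locales
  let ?S = "carrier V \<times> carrier W"
  let ?F = "free_space K ?S"
  let ?q = "\<lambda>x. tensor_null K V W +>\<^bsub>?F\<^esub> x"
  interpret F: vectorspace K ?F by (rule free_space_vectorspace[OF K])
  interpret T: vectorspace K "V \<boxtimes>\<^bsub>K\<^esub> W" by (rule tensor_space_vectorspace[OF V W])
  interpret q: mod_hom K ?F "V \<boxtimes>\<^bsub>K\<^esub> W" ?q
    unfolding tensor_space_def
    by (rule quot_space_module(2)[OF F.module_axioms tensor_null_submodule[OF V W]])
  obtain f where f: "f \<in> carrier ?F" "x = ?q f"
    using x by (auto simp: tensor_space_def quot_space_def A_RCOSETS_def')
  have "P (?q f)"
  proof (rule free_space_induct[OF K f(1)])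
    show "P (?q \<zero>\<^bsub>?F\<^esub>)" using zero by simp
  next
    fix f c x assume f: "f \<in> carrier ?F" "P (?q f)" and c: "c \<in> carrier K" and "x \<in> ?S"
    then obtain v w where x: "x = (v, w)" "v \<in> carrier V" "w \<in> carrier W" by auto
    have e: "free_gen K ?S x \<in> carrier ?F" using x by (intro free_gen_closed[OF K]) simp
    \<comment> \<open>A scalar is absorbed by the first factor, which is why the induction has no
      case for scalar multiples.\<close>
    have "c \<odot>\<^bsub>V \<boxtimes>\<^bsub>K\<^esub> W\<^esub> ?q (free_gen K ?S x) = pure_tensor K V W (c \<odot>\<^bsub>V\<^esub> v) w"
      using linear_mapD(6)[OF linear_map_pure_left[OF W x(3) linear_map_id[OF V]] c x(2)]
      by (simp add: pure_tensor_def x)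
    then show "P (?q (f \<oplus>\<^bsub>?F\<^esub> (c \<odot>\<^bsub>?F\<^esub> free_gen K ?S x)))"
      using f c x e by (simp add: add pure pure_tensor_closed V W)
  qed
  with f show ?thesis by simp
qed

lemma tensor_ext3:
  assumes f: "linear_map K (U \<boxtimes>\<^bsub>K\<^esub> V \<boxtimes>\<^bsub>K\<^esub> W) Z f"
    and g: "linear_map K (U \<boxtimes>\<^bsub>K\<^esub> V \<boxtimes>\<^bsub>K\<^esub> W) Z g"
    and U: "vectorspace K U" and V: "vectorspace K V" and W: "vectorspace K W"
    and eq: "\<And>u v w. u \<in> carrier U \<Longrightarrow> v \<in> carrier V \<Longrightarrow> w \<in> carrier W \<Longrightarrow>
      f (pure_tensor K U (V \<boxtimes>\<^bsub>K\<^esub> W) u (pure_tensor K V W v w))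
        = g (pure_tensor K U (V \<boxtimes>\<^bsub>K\<^esub> W) u (pure_tensor K V W v w))"
    and x: "x \<in> carrier (U \<boxtimes>\<^bsub>K\<^esub> V \<boxtimes>\<^bsub>K\<^esub> W)"
  shows "f x = g x"
proof (rule tensor_ext[OF f g U tensor_space_vectorspace[OF V W] _ x])
  fix u t assume u: "u \<in> carrier U" and t: "t \<in> carrier (V \<boxtimes>\<^bsub>K\<^esub> W)"
  show "f (pure_tensor K U (V \<boxtimes>\<^bsub>K\<^esub> W) u t) = g (pure_tensor K U (V \<boxtimes>\<^bsub>K\<^esub> W) u t)"
    by (rule tensor_ext[OF linear_map_compose[OF f] linear_map_compose[OF g] V W _ t])
      (intro linear_map_pure_right linear_map_id tensor_space_vectorspace U V W u eq; assumption)+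
qed

lemma tensor_map_bilinear:
  assumes "linear_map K V V' f" "linear_map K W W' g"
  shows "bilinear_map K V W (V' \<boxtimes>\<^bsub>K\<^esub> W') (\<lambda>v w. pure_tensor K V' W' (f v) (g w))"
  by (intro bilinear_mapI linear_map_pure_left linear_map_pure_right assms
      linear_mapD(2)[OF assms(1)] linear_mapD(2)[OF assms(2)] linear_mapD(3)[OF assms(1)]
      linear_mapD(3)[OF assms(2)])

lemma tensor_map:
  assumes f: "linear_map K V V' f" and g: "linear_map K W W' g"
  shows "linear_map K (V \<boxtimes>\<^bsub>K\<^esub> W) (V' \<boxtimes>\<^bsub>K\<^esub> W') (tensor_map K V V' W W' f g)"
    and "v \<in> carrier V \<Longrightarrow> w \<in> carrier W \<Longrightarrow>
      tensor_map K V V' W W' f g (pure_tensor K V W v w) = pure_tensor K V' W' (f v) (g w)"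
  using tensor_lift[OF linear_mapD(1)[OF f] linear_mapD(1)[OF g] tensor_space_vectorspace
      [OF linear_mapD(2)[OF f] linear_mapD(2)[OF g]] tensor_map_bilinear[OF f g]]
  by (simp_all add: tensor_map_def)

lemma tensor_flip:
  assumes V: "vectorspace K V" and W: "vectorspace K W"
  shows "linear_map K (V \<boxtimes>\<^bsub>K\<^esub> W) (W \<boxtimes>\<^bsub>K\<^esub> V) (tensor_flip K V W)"
    and "v \<in> carrier V \<Longrightarrow> w \<in> carrier W \<Longrightarrow>
      tensor_flip K V W (pure_tensor K V W v w) = pure_tensor K W V w v"
proof -
  have "bilinear_map K V W (W \<boxtimes>\<^bsub>K\<^esub> V) (\<lambda>v w. pure_tensor K W V w v)"
    by (intro bilinear_mapI linear_map_pure_left linear_map_pure_right linear_map_id assms)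
  note t = tensor_lift[OF V W tensor_space_vectorspace[OF W V] this]
  show "linear_map K (V \<boxtimes>\<^bsub>K\<^esub> W) (W \<boxtimes>\<^bsub>K\<^esub> V) (tensor_flip K V W)"
    and "v \<in> carrier V \<Longrightarrow> w \<in> carrier W \<Longrightarrow>
      tensor_flip K V W (pure_tensor K V W v w) = pure_tensor K W V w v"
    using t by (simp_all add: tensor_flip_def)
qed

text \<open>The parameter sits inside the lifted bilinear map, so the universal property says
  nothing about it. For pure \<open>t\<close> the claim is the hypothesis \<open>lin\<close>, and
  sums of linear maps are linear. The nested lifts in the two associators need this to be
  bilinear.\<close>

lemma tensor_lift_linear_param:
  assumes U: "vectorspace K U" and V: "vectorspace K V" and W: "vectorspace K W"
    and Z: "vectorspace K Z"
    and b: "\<And>u. u \<in> carrier U \<Longrightarrow> bilinear_map K V W Z (b u)"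
    and lin: "\<And>v w. v \<in> carrier V \<Longrightarrow> w \<in> carrier W \<Longrightarrow> linear_map K U Z (\<lambda>u. b u v w)"
    and t: "t \<in> carrier (V \<boxtimes>\<^bsub>K\<^esub> W)"
  shows "linear_map K U Z (\<lambda>u. tensor_lift K V W Z (b u) t)"
  using V W t
proof (induction t rule: tensor_induct)
  case (pure v w)
  show ?case
    by (rule linear_map_cong[OF lin[OF pure]]) (simp add: tensor_lift(2)[OF V W Z b] pure)
next
  case zero
  have "linear_map K U Z (\<lambda>u. \<zero>\<^bsub>Z\<^esub>)"
  proof -
    interpret Z: vectorspace K Z by fact
    show ?thesis by (rule linear_mapI) (simp_all add: U Z Z.smult_r_null)
  qed
  then show ?case
    by (rule linear_map_cong) (simp add: linear_mapD(7)[OF tensor_lift(1)[OF V W Z b]])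
next
  case (add x y)
  show ?case
    by (rule linear_map_cong[OF linear_map_plus[OF add(3,4)]])
      (simp add: linear_mapD(4)[OF tensor_lift(1)[OF V W Z b]] add)
qed

lemma tensor_assoc_right:
  assumes U: "vectorspace K U" and V: "vectorspace K V" and W: "vectorspace K W"
  shows "linear_map K ((U \<boxtimes>\<^bsub>K\<^esub> V) \<boxtimes>\<^bsub>K\<^esub> W) (U \<boxtimes>\<^bsub>K\<^esub> V \<boxtimes>\<^bsub>K\<^esub> W) (tensor_assoc_right K U V W)"
    (is ?lin)
    and "u \<in> carrier U \<Longrightarrow> v \<in> carrier V \<Longrightarrow> w \<in> carrier W \<Longrightarrow>
      tensor_assoc_right K U V W (pure_tensor K (U \<boxtimes>\<^bsub>K\<^esub> V) W (pure_tensor K U V u v) w)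
        = pure_tensor K U (V \<boxtimes>\<^bsub>K\<^esub> W) u (pure_tensor K V W v w)" (is "PROP ?pure")
proof -
  let ?Z = "U \<boxtimes>\<^bsub>K\<^esub> V \<boxtimes>\<^bsub>K\<^esub> W"
  note UV = tensor_space_vectorspace[OF U V] and VW = tensor_space_vectorspace[OF V W]
  note Z = tensor_space_vectorspace[OF U VW]
  have b: "bilinear_map K U V ?Z (\<lambda>u v. pure_tensor K U (V \<boxtimes>\<^bsub>K\<^esub> W) u (pure_tensor K V W v w))"
    if "w \<in> carrier W" for w
    by (intro bilinear_mapI linear_map_pure_left linear_map_pure_right linear_map_id
        pure_tensor_closed tensor_space_vectorspace assms that)
  have "bilinear_map K (U \<boxtimes>\<^bsub>K\<^esub> V) W ?Z (\<lambda>t w. tensor_lift K U V ?Z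
        (\<lambda>u v. pure_tensor K U (V \<boxtimes>\<^bsub>K\<^esub> W) u (pure_tensor K V W v w)) t)"
    by (intro bilinear_mapI tensor_lift_linear_param tensor_lift(1) b linear_map_pure_right
        linear_map_id assms VW Z; assumption)
  note t = tensor_lift[OF UV W Z this]
  show ?lin using t(1) by (simp add: tensor_assoc_right_def)
  show "PROP ?pure" using t(2) tensor_lift(2)[OF U V Z b]
    by (simp add: tensor_assoc_right_def pure_tensor_closed U V)
qed

lemma tensor_assoc_left:
  assumes U: "vectorspace K U" and V: "vectorspace K V" and W: "vectorspace K W"
  shows "linear_map K (U \<boxtimes>\<^bsub>K\<^esub> V \<boxtimes>\<^bsub>K\<^esub> W) ((U \<boxtimes>\<^bsub>K\<^esub> V) \<boxtimes>\<^bsub>K\<^esub> W) (tensor_assoc_left K U V W)"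
    (is ?lin)
    and "u \<in> carrier U \<Longrightarrow> v \<in> carrier V \<Longrightarrow> w \<in> carrier W \<Longrightarrow>
      tensor_assoc_left K U V W (pure_tensor K U (V \<boxtimes>\<^bsub>K\<^esub> W) u (pure_tensor K V W v w))
        = pure_tensor K (U \<boxtimes>\<^bsub>K\<^esub> V) W (pure_tensor K U V u v) w" (is "PROP ?pure")
proof -
  let ?Z = "(U \<boxtimes>\<^bsub>K\<^esub> V) \<boxtimes>\<^bsub>K\<^esub> W"
  note UV = tensor_space_vectorspace[OF U V] and VW = tensor_space_vectorspace[OF V W]
  note Z = tensor_space_vectorspace[OF UV W]
  have b: "bilinear_map K V W ?Z (\<lambda>v w. pure_tensor K (U \<boxtimes>\<^bsub>K\<^esub> V) W (pure_tensor K U V u v) w)"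
    if "u \<in> carrier U" for u
    by (intro bilinear_mapI linear_map_pure_left linear_map_pure_right linear_map_id
        pure_tensor_closed tensor_space_vectorspace assms that)
  have "bilinear_map K U (V \<boxtimes>\<^bsub>K\<^esub> W) ?Z (\<lambda>u t. tensor_lift K V W ?Z
        (\<lambda>v w. pure_tensor K (U \<boxtimes>\<^bsub>K\<^esub> V) W (pure_tensor K U V u v) w) t)"
    by (intro bilinear_mapI tensor_lift_linear_param tensor_lift(1) b linear_map_pure_left
        linear_map_id assms UV Z; assumption)
  note t = tensor_lift[OF U VW Z this]
  show ?lin using t(1) by (simp add: tensor_assoc_left_def)
  show "PROP ?pure" using t(2) tensor_lift(2)[OF V W Z b]
    by (simp add: tensor_assoc_left_def pure_tensor_closed V W)
qed

lemma tensor_flip_id: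
  assumes U: "vectorspace K U" and V: "vectorspace K V" and W: "vectorspace K W"
  shows "linear_map K (U \<boxtimes>\<^bsub>K\<^esub> V \<boxtimes>\<^bsub>K\<^esub> W) (V \<boxtimes>\<^bsub>K\<^esub> U \<boxtimes>\<^bsub>K\<^esub> W) (tensor_flip_id K U V W)"
    and "u \<in> carrier U \<Longrightarrow> v \<in> carrier V \<Longrightarrow> w \<in> carrier W \<Longrightarrow>
      tensor_flip_id K U V W (pure_tensor K U (V \<boxtimes>\<^bsub>K\<^esub> W) u (pure_tensor K V W v w))
        = pure_tensor K V (U \<boxtimes>\<^bsub>K\<^esub> W) v (pure_tensor K U W u w)"
proof -
  have f: "linear_map K ((U \<boxtimes>\<^bsub>K\<^esub> V) \<boxtimes>\<^bsub>K\<^esub> W) ((V \<boxtimes>\<^bsub>K\<^esub> U) \<boxtimes>\<^bsub>K\<^esub> W)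
      (tensor_map K (U \<boxtimes>\<^bsub>K\<^esub> V) (V \<boxtimes>\<^bsub>K\<^esub> U) W W (tensor_flip K U V) id)"
    unfolding id_def by (rule tensor_map(1)[OF tensor_flip(1)[OF U V] linear_map_id[OF W]])
  show "linear_map K (U \<boxtimes>\<^bsub>K\<^esub> V \<boxtimes>\<^bsub>K\<^esub> W) (V \<boxtimes>\<^bsub>K\<^esub> U \<boxtimes>\<^bsub>K\<^esub> W) (tensor_flip_id K U V W)"
    unfolding tensor_flip_id_def o_def
    by (rule linear_map_compose[OF tensor_assoc_right(1)[OF V U W]
        linear_map_compose[OF f tensor_assoc_left(1)[OF U V W]]])
  show "u \<in> carrier U \<Longrightarrow> v \<in> carrier V \<Longrightarrow> w \<in> carrier W \<Longrightarrow>
      tensor_flip_id K U V W (pure_tensor K U (V \<boxtimes>\<^bsub>K\<^esub> W) u (pure_tensor K V W v w))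
        = pure_tensor K V (U \<boxtimes>\<^bsub>K\<^esub> W) v (pure_tensor K U W u w)"
    by (simp add: tensor_flip_id_def id_def tensor_assoc_left(2) tensor_assoc_right(2)
        tensor_map(2)[OF tensor_flip(1)[OF U V] linear_map_id[OF W]] tensor_flip(2)
        pure_tensor_closed assms)
qed

section \<open>Functoriality and naturality of tensor maps, associator and flip\<close>

lemma linear_map_id': "vectorspace K V \<Longrightarrow> linear_map K V V id"
  using linear_map_id by (simp add: id_def)

lemma tensor_map_compose:
  assumes f: "linear_map K V V' f" and f': "linear_map K V' V'' f'"
    and g: "linear_map K W W' g" and g': "linear_map K W' W'' g'"
    and x: "x \<in> carrier (V \<boxtimes>\<^bsub>K\<^esub> W)"
  shows "tensor_map K V' V'' W' W'' f' g' (tensor_map K V V' W W' f g x)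
    = tensor_map K V V'' W W'' (\<lambda>v. f' (f v)) (\<lambda>w. g' (g w)) x"
proof (rule tensor_ext[OF linear_map_compose[OF tensor_map(1)[OF f' g'] tensor_map(1)[OF f g]]
      tensor_map(1)[OF linear_map_compose[OF f' f] linear_map_compose[OF g' g]]
      linear_mapD(1)[OF f] linear_mapD(1)[OF g] _ x])
  fix v w assume "v \<in> carrier V" "w \<in> carrier W"
  then show "tensor_map K V' V'' W' W'' f' g' (tensor_map K V V' W W' f g (pure_tensor K V W v w))
    = tensor_map K V V'' W W'' (\<lambda>v. f' (f v)) (\<lambda>w. g' (g w)) (pure_tensor K V W v w)"
    by (simp add: tensor_map(2)[OF f g] tensor_map(2)[OF f' g'] linear_mapD(3)[OF f]
        linear_mapD(3)[OF g] tensor_map(2)[OF linear_map_compose[OF f' f] linear_map_compose[OF g' g]])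
qed

text \<open>Covers tensors that enter through a factor of a tensor map, as \<open>x\<close> does in
  \<open>\<lambda>n. tensor_append K U M N n x\<close>.\<close>

lemma tensor_map_linear_param:
  assumes f: "linear_map K V V' f"
    and g: "\<And>z. z \<in> carrier Z \<Longrightarrow> linear_map K W W' (g z)"
    and lin: "\<And>w. w \<in> carrier W \<Longrightarrow> linear_map K Z W' (\<lambda>z. g z w)"
    and vs: "vectorspace K Z" "vectorspace K W" "vectorspace K W'"
    and x: "x \<in> carrier (V \<boxtimes>\<^bsub>K\<^esub> W)"
  shows "linear_map K Z (V' \<boxtimes>\<^bsub>K\<^esub> W') (\<lambda>z. tensor_map K V V' W W' f (g z) x)"
  unfolding tensor_map_def
  by (intro tensor_lift_linear_param vs linear_mapD(1)[OF f] tensor_space_vectorspace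
      linear_mapD(2)[OF f] tensor_map_bilinear[OF f g] linear_map_pure_right
      linear_mapD(3)[OF f] lin x)

text \<open>The third factor is kept as a single vector, so that the identity is linear in
  \<open>z\<close> alone; this is the shape that \<open>tensor_append\<close> uses.\<close>

lemma tensor_assoc_right_natural:
  assumes f: "linear_map K U U' f" and g: "linear_map K V V' g" and h: "linear_map K W W' h"
    and z: "z \<in> carrier (U \<boxtimes>\<^bsub>K\<^esub> V)" and w: "w \<in> carrier W"
  shows "tensor_assoc_right K U' V' W'
      (pure_tensor K (U' \<boxtimes>\<^bsub>K\<^esub> V') W' (tensor_map K U U' V V' f g z) (h w))
    = tensor_map K U U' (V \<boxtimes>\<^bsub>K\<^esub> W) (V' \<boxtimes>\<^bsub>K\<^esub> W') f (tensor_map K V V' W W' g h)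
        (tensor_assoc_right K U V W (pure_tensor K (U \<boxtimes>\<^bsub>K\<^esub> V) W z w))"
proof -
  note vs = linear_mapD(1,2)[OF f] linear_mapD(1,2)[OF g] linear_mapD(1,2)[OF h]
  note lin = linear_mapD(3)[OF f] linear_mapD(3)[OF g] linear_mapD(3)[OF h]
  note gh = tensor_map(1)[OF g h]
  show ?thesis
    by (rule tensor_ext[OF linear_map_compose[OF tensor_assoc_right(1) linear_map_pure_left]
          linear_map_compose[OF tensor_map(1)[OF f gh] linear_map_compose[OF tensor_assoc_right(1)
          linear_map_pure_left]] _ _ _ z])
      (simp_all add: vs lin w tensor_map(1)[OF f g] linear_map_id tensor_space_vectorspace
        pure_tensor_closed tensor_map(2)[OF f g] tensor_map(2)[OF g h] tensor_map(2)[OF f gh]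
        tensor_assoc_right(2))
qed

lemma tensor_flip_id_involution:
  assumes U: "vectorspace K U" and V: "vectorspace K V" and W: "vectorspace K W"
    and x: "x \<in> carrier (U \<boxtimes>\<^bsub>K\<^esub> V \<boxtimes>\<^bsub>K\<^esub> W)"
  shows "tensor_flip_id K V U W (tensor_flip_id K U V W x) = x"
  by (rule tensor_ext3[OF linear_map_compose[OF tensor_flip_id(1) tensor_flip_id(1)] linear_map_id
        _ _ _ _ x])
    (simp_all add: assms tensor_space_vectorspace tensor_flip_id(2))

lemma tensor_flip_id_natural:
  assumes f: "linear_map K U U' f" and g: "linear_map K V V' g" and h: "linear_map K W W' h"
    and x: "x \<in> carrier (U \<boxtimes>\<^bsub>K\<^esub> V \<boxtimes>\<^bsub>K\<^esub> W)"
  shows "tensor_flip_id K U' V' W'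
      (tensor_map K U U' (V \<boxtimes>\<^bsub>K\<^esub> W) (V' \<boxtimes>\<^bsub>K\<^esub> W') f (tensor_map K V V' W W' g h) x)
    = tensor_map K V V' (U \<boxtimes>\<^bsub>K\<^esub> W) (U' \<boxtimes>\<^bsub>K\<^esub> W') g (tensor_map K U U' W W' f h)
        (tensor_flip_id K U V W x)"
proof -
  note vs = linear_mapD(1,2)[OF f] linear_mapD(1,2)[OF g] linear_mapD(1,2)[OF h]
  note lin = linear_mapD(3)[OF f] linear_mapD(3)[OF g] linear_mapD(3)[OF h]
  note gh = tensor_map[OF g h] and fh = tensor_map[OF f h]
  show ?thesis
    by (rule tensor_ext3[OF linear_map_compose[OF tensor_flip_id(1) tensor_map(1)[OF f gh(1)]]
          linear_map_compose[OF tensor_map(1)[OF g fh(1)] tensor_flip_id(1)] _ _ _ _ x])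
      (simp_all add: vs lin pure_tensor_closed gh(2) fh(2) tensor_map(2)[OF f gh(1)]
        tensor_map(2)[OF g fh(1)] tensor_flip_id(2))
qed

section \<open>Inserting a factor\<close>

text \<open>On pure tensors the value is \<open>u \<otimes> v \<otimes> w\<close>. The body copies
  the first summand of \<open>tensor_coaction\<close> at \<open>m \<otimes> n\<close>, where
  \<open>w\<close> is \<open>\<alpha>2 n\<close>.\<close>

definition tensor_append ::
    "('k, 'r) ring_scheme \<Rightarrow> ('k, 'u, 'd) module_scheme \<Rightarrow> ('k, 'v, 'e) module_scheme
      \<Rightarrow> ('k, 'w, 'f) module_scheme
      \<Rightarrow> 'w \<Rightarrow> ('u \<times> 'v \<Rightarrow> 'k) set \<Rightarrow> ('u \<times> ('v \<times> 'w \<Rightarrow> 'k) set \<Rightarrow> 'k) set"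
  where "tensor_append K U V W w x =
    tensor_assoc_right K U V W (pure_tensor K (U \<boxtimes>\<^bsub>K\<^esub> V) W x w)"

text \<open>On \<open>u \<otimes> w\<close> the value is \<open>u \<otimes> v \<otimes> w\<close>.
  Putting \<open>v\<close> in front and then swapping copies the second summand of
  \<open>tensor_coaction\<close>, where \<open>v\<close> is \<open>\<alpha>1 m\<close>.\<close>

definition tensor_insert ::
    "('k, 'r) ring_scheme \<Rightarrow> ('k, 'u, 'd) module_scheme \<Rightarrow> ('k, 'v, 'e) module_scheme
      \<Rightarrow> ('k, 'w, 'f) module_scheme
      \<Rightarrow> 'v \<Rightarrow> ('u \<times> 'w \<Rightarrow> 'k) set \<Rightarrow> ('u \<times> ('v \<times> 'w \<Rightarrow> 'k) set \<Rightarrow> 'k) set"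
  where "tensor_insert K U V W v x =
    tensor_flip_id K V U W (pure_tensor K V (U \<boxtimes>\<^bsub>K\<^esub> W) v x)"

lemma tensor_append:
  assumes "vectorspace K U" "vectorspace K V" "vectorspace K W"
  shows "w \<in> carrier W \<Longrightarrow> linear_map K (U \<boxtimes>\<^bsub>K\<^esub> V) (U \<boxtimes>\<^bsub>K\<^esub> V \<boxtimes>\<^bsub>K\<^esub> W) (tensor_append K U V W w)"
    and "x \<in> carrier (U \<boxtimes>\<^bsub>K\<^esub> V) \<Longrightarrow>
      linear_map K W (U \<boxtimes>\<^bsub>K\<^esub> V \<boxtimes>\<^bsub>K\<^esub> W) (\<lambda>w. tensor_append K U V W w x)"
    and "u \<in> carrier U \<Longrightarrow> v \<in> carrier V \<Longrightarrow> w \<in> carrier W \<Longrightarrow>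
      tensor_append K U V W w (pure_tensor K U V u v)
        = pure_tensor K U (V \<boxtimes>\<^bsub>K\<^esub> W) u (pure_tensor K V W v w)"
  unfolding tensor_append_def
  by (intro linear_map_compose[OF tensor_assoc_right(1)] linear_map_pure_left linear_map_pure_right
      linear_map_id tensor_space_vectorspace assms tensor_assoc_right(2); assumption)+

lemma tensor_insert:
  assumes "vectorspace K U" "vectorspace K V" "vectorspace K W"
  shows "v \<in> carrier V \<Longrightarrow> linear_map K (U \<boxtimes>\<^bsub>K\<^esub> W) (U \<boxtimes>\<^bsub>K\<^esub> V \<boxtimes>\<^bsub>K\<^esub> W) (tensor_insert K U V W v)"
    and "x \<in> carrier (U \<boxtimes>\<^bsub>K\<^esub> W) \<Longrightarrow>
      linear_map K V (U \<boxtimes>\<^bsub>K\<^esub> V \<boxtimes>\<^bsub>K\<^esub> W) (\<lambda>v. tensor_insert K U V W v x)"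
    and "u \<in> carrier U \<Longrightarrow> v \<in> carrier V \<Longrightarrow> w \<in> carrier W \<Longrightarrow>
      tensor_insert K U V W v (pure_tensor K U W u w)
        = pure_tensor K U (V \<boxtimes>\<^bsub>K\<^esub> W) u (pure_tensor K V W v w)"
  unfolding tensor_insert_def
  by (intro linear_map_compose[OF tensor_flip_id(1)] linear_map_pure_left linear_map_pure_right
      linear_map_id tensor_space_vectorspace assms tensor_flip_id(2); assumption)+

lemma tensor_append_natural:
  assumes f: "linear_map K U U' f" and g: "linear_map K V V' g" and h: "linear_map K W W' h"
    and w: "w \<in> carrier W" and x: "x \<in> carrier (U \<boxtimes>\<^bsub>K\<^esub> V)"
  shows "tensor_map K U U' (V \<boxtimes>\<^bsub>K\<^esub> W) (V' \<boxtimes>\<^bsub>K\<^esub> W') f (tensor_map K V V' W W' g h)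
      (tensor_append K U V W w x)
    = tensor_append K U' V' W' (h w) (tensor_map K U U' V V' f g x)"
  unfolding tensor_append_def by (rule tensor_assoc_right_natural[OF f g h x w, symmetric])

lemma tensor_insert_natural:
  assumes f: "linear_map K U U' f" and g: "linear_map K V V' g" and h: "linear_map K W W' h"
    and v: "v \<in> carrier V" and x: "x \<in> carrier (U \<boxtimes>\<^bsub>K\<^esub> W)"
  shows "tensor_map K U U' (V \<boxtimes>\<^bsub>K\<^esub> W) (V' \<boxtimes>\<^bsub>K\<^esub> W') f (tensor_map K V V' W W' g h)
      (tensor_insert K U V W v x)
    = tensor_insert K U' V' W' (g v) (tensor_map K U U' W W' f h x)"
proof -
  note vs = linear_mapD(1)[OF f] linear_mapD(1)[OF g] linear_mapD(1)[OF h]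
  show ?thesis
    unfolding tensor_insert_def
    by (simp add: tensor_flip_id_natural[OF g f h, symmetric] pure_tensor_closed vs v x
        tensor_space_vectorspace tensor_map(2)[OF g tensor_map(1)[OF f h]])
qed

text \<open>The pentagon identity for the associator, read with the last two factors held
  fixed.\<close>

lemma tensor_append_assoc:
  assumes vs: "vectorspace K U" "vectorspace K V" "vectorspace K M" "vectorspace K N"
    and z: "z \<in> carrier (U \<boxtimes>\<^bsub>K\<^esub> V)" and m: "m \<in> carrier M" and n: "n \<in> carrier N"
  shows "tensor_map K U U (V \<boxtimes>\<^bsub>K\<^esub> M) (V \<boxtimes>\<^bsub>K\<^esub> M \<boxtimes>\<^bsub>K\<^esub> N) id (tensor_append K V M N n)
      (tensor_append K U V M m z)
    = tensor_append K U V (M \<boxtimes>\<^bsub>K\<^esub> N) (pure_tensor K M N m n) z"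
proof -
  note V = vs tensor_space_vectorspace[OF vs(3,4)]
  note f = tensor_map[OF linear_map_id'[OF vs(1)] tensor_append(1)[OF vs(2-4) n]]
  show ?thesis
    by (rule tensor_ext[OF linear_map_compose[OF f(1) tensor_append(1)] tensor_append(1) _ _ _ z])
      (simp_all add: V m n f(2) pure_tensor_closed tensor_append(3))
qed

text \<open>The same four-fold tensor, reached by attaching \<open>n\<close> first and then slipping
  \<open>m\<close> in before it.\<close>

lemma tensor_insert_assoc:
  assumes vs: "vectorspace K U" "vectorspace K V" "vectorspace K M" "vectorspace K N"
    and z: "z \<in> carrier (U \<boxtimes>\<^bsub>K\<^esub> V)" and m: "m \<in> carrier M" and n: "n \<in> carrier N"
  shows "tensor_map K U U (V \<boxtimes>\<^bsub>K\<^esub> N) (V \<boxtimes>\<^bsub>K\<^esub> M \<boxtimes>\<^bsub>K\<^esub> N) id (tensor_insert K V M N m)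
      (tensor_append K U V N n z)
    = tensor_append K U V (M \<boxtimes>\<^bsub>K\<^esub> N) (pure_tensor K M N m n) z"
proof -
  note V = vs tensor_space_vectorspace[OF vs(3,4)]
  note f = tensor_map[OF linear_map_id'[OF vs(1)] tensor_insert(1)[OF vs(2-4) m]]
  show ?thesis
    by (rule tensor_ext[OF linear_map_compose[OF f(1) tensor_append(1)] tensor_append(1) _ _ _ z])
      (simp_all add: V m n f(2) pure_tensor_closed tensor_append(3) tensor_insert(3))
qed

text \<open>The new factor lies to the right of the two that are exchanged. This is not an instance
  of \<open>tensor_flip_id_natural\<close>, because appending does not split into separate maps on
  the second and third factors.\<close>

lemma tensor_flip_id_map_append:
  assumes vs: "vectorspace K U" "vectorspace K V" "vectorspace K M" "vectorspace K N"
    and n: "n \<in> carrier N" and x: "x \<in> carrier (U \<boxtimes>\<^bsub>K\<^esub> V \<boxtimes>\<^bsub>K\<^esub> M)"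
  shows "tensor_flip_id K U V (M \<boxtimes>\<^bsub>K\<^esub> N)
      (tensor_map K U U (V \<boxtimes>\<^bsub>K\<^esub> M) (V \<boxtimes>\<^bsub>K\<^esub> M \<boxtimes>\<^bsub>K\<^esub> N) id (tensor_append K V M N n) x)
    = tensor_map K V V (U \<boxtimes>\<^bsub>K\<^esub> M) (U \<boxtimes>\<^bsub>K\<^esub> M \<boxtimes>\<^bsub>K\<^esub> N) id (tensor_append K U M N n)
        (tensor_flip_id K U V M x)"
proof -
  note V = vs tensor_space_vectorspace[OF vs(3,4)]
  note f = tensor_map[OF linear_map_id'[OF vs(1)] tensor_append(1)[OF vs(2-4) n]]
  note g = tensor_map[OF linear_map_id'[OF vs(2)] tensor_append(1)[OF vs(1,3,4) n]]
  show ?thesis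
    by (rule tensor_ext3[OF linear_map_compose[OF tensor_flip_id(1) f(1)]
          linear_map_compose[OF g(1) tensor_flip_id(1)] _ _ _ _ x])
      (simp_all add: V n f(2) g(2) pure_tensor_closed tensor_append(3) tensor_flip_id(2))
qed

lemma tensor_flip_id_map_insert:
  assumes vs: "vectorspace K U" "vectorspace K V" "vectorspace K M" "vectorspace K N"
    and m: "m \<in> carrier M" and x: "x \<in> carrier (U \<boxtimes>\<^bsub>K\<^esub> V \<boxtimes>\<^bsub>K\<^esub> N)"
  shows "tensor_flip_id K U V (M \<boxtimes>\<^bsub>K\<^esub> N)
      (tensor_map K U U (V \<boxtimes>\<^bsub>K\<^esub> N) (V \<boxtimes>\<^bsub>K\<^esub> M \<boxtimes>\<^bsub>K\<^esub> N) id (tensor_insert K V M N m) x)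
    = tensor_map K V V (U \<boxtimes>\<^bsub>K\<^esub> N) (U \<boxtimes>\<^bsub>K\<^esub> M \<boxtimes>\<^bsub>K\<^esub> N) id (tensor_insert K U M N m)
        (tensor_flip_id K U V N x)"
proof -
  note V = vs tensor_space_vectorspace[OF vs(3,4)]
  note f = tensor_map[OF linear_map_id'[OF vs(1)] tensor_insert(1)[OF vs(2-4) m]]
  note g = tensor_map[OF linear_map_id'[OF vs(2)] tensor_insert(1)[OF vs(1,3,4) m]]
  show ?thesis
    by (rule tensor_ext3[OF linear_map_compose[OF tensor_flip_id(1) f(1)]
          linear_map_compose[OF g(1) tensor_flip_id(1)] _ _ _ _ x])
      (simp_all add: V m f(2) g(2) pure_tensor_closed tensor_insert(3) tensor_flip_id(2))
qed

text \<open>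
  Both sides are the image of \<open>x \<otimes> y\<close> under
  \<open>(l \<otimes> m) \<otimes> (l' \<otimes> n) \<mapsto> l \<otimes> l' \<otimes> m \<otimes> n\<close>: the two ways in which the mixed terms of a composite of
  coactions arise.
\<close>

lemma tensor_flip_id_mixed:
  assumes vs: "vectorspace K U" "vectorspace K V" "vectorspace K M" "vectorspace K N"
    and x: "x \<in> carrier (U \<boxtimes>\<^bsub>K\<^esub> M)" and y: "y \<in> carrier (V \<boxtimes>\<^bsub>K\<^esub> N)"
  shows "tensor_flip_id K V U (M \<boxtimes>\<^bsub>K\<^esub> N)
      (tensor_map K V V N (U \<boxtimes>\<^bsub>K\<^esub> M \<boxtimes>\<^bsub>K\<^esub> N) id (\<lambda>n. tensor_append K U M N n x) y)
    = tensor_map K U U M (V \<boxtimes>\<^bsub>K\<^esub> M \<boxtimes>\<^bsub>K\<^esub> N) id (\<lambda>m. tensor_insert K V M N m y) x"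
proof -
  note V = vs tensor_space_vectorspace[OF vs(3,4)] tensor_space_vectorspace
  note fl = tensor_flip_id[OF vs(2,1) V(5)]
  note id = linear_map_id'[OF vs(1)] linear_map_id'[OF vs(2)]
  note ap = tensor_append[OF vs(1,3,4)] and ins = tensor_insert[OF vs(2-4)]
  show ?thesis
  proof (rule tensor_ext[OF _ _ vs(1,3) _ x])
    show "linear_map K (U \<boxtimes>\<^bsub>K\<^esub> M) (U \<boxtimes>\<^bsub>K\<^esub> V \<boxtimes>\<^bsub>K\<^esub> M \<boxtimes>\<^bsub>K\<^esub> N) (\<lambda>x. tensor_flip_id K V U (M \<boxtimes>\<^bsub>K\<^esub> N)
      (tensor_map K V V N (U \<boxtimes>\<^bsub>K\<^esub> M \<boxtimes>\<^bsub>K\<^esub> N) id (\<lambda>n. tensor_append K U M N n x) y))"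
      \<comment> \<open>Here \<open>x\<close> occurs only inside the function that is being
        tensored, so composing linear maps does not suffice and linearity in a parameter is
        used.\<close>
      by (intro linear_map_compose[OF fl(1)] tensor_map_linear_param id ap V y; assumption)
    show "linear_map K (U \<boxtimes>\<^bsub>K\<^esub> M) (U \<boxtimes>\<^bsub>K\<^esub> V \<boxtimes>\<^bsub>K\<^esub> M \<boxtimes>\<^bsub>K\<^esub> N)
      (tensor_map K U U M (V \<boxtimes>\<^bsub>K\<^esub> M \<boxtimes>\<^bsub>K\<^esub> N) id (\<lambda>m. tensor_insert K V M N m y))"
      by (rule tensor_map(1)[OF id(1) ins(2)[OF y]])
    fix u m assume um: "u \<in> carrier U" "m \<in> carrier M"
    let ?x = "pure_tensor K U M u m"
    have x: "?x \<in> carrier (U \<boxtimes>\<^bsub>K\<^esub> M)" by (simp add: pure_tensor_closed um vs)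
    note f = tensor_map[OF id(2) ap(2)[OF x]]
    \<comment> \<open>With \<open>x\<close> now pure, the right-hand side is an expression linear in
      \<open>y\<close>, and a second extension runs over \<open>y\<close>.\<close>
    have "tensor_flip_id K V U (M \<boxtimes>\<^bsub>K\<^esub> N)
      (tensor_map K V V N (U \<boxtimes>\<^bsub>K\<^esub> M \<boxtimes>\<^bsub>K\<^esub> N) id (\<lambda>n. tensor_append K U M N n ?x) y)
      = pure_tensor K U (V \<boxtimes>\<^bsub>K\<^esub> M \<boxtimes>\<^bsub>K\<^esub> N) u (tensor_insert K V M N m y)"
      by (rule tensor_ext[OF linear_map_compose[OF fl(1) f(1)]
            linear_map_pure_right[OF vs(1) um(1) ins(1)[OF um(2)]] vs(2,4) _ y])
        (simp add: f(2) ap(3) ins(3) fl(2) um pure_tensor_closed V)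
    then show "tensor_flip_id K V U (M \<boxtimes>\<^bsub>K\<^esub> N)
      (tensor_map K V V N (U \<boxtimes>\<^bsub>K\<^esub> M \<boxtimes>\<^bsub>K\<^esub> N) id (\<lambda>n. tensor_append K U M N n ?x) y)
      = tensor_map K U U M (V \<boxtimes>\<^bsub>K\<^esub> M \<boxtimes>\<^bsub>K\<^esub> N) id (\<lambda>m. tensor_insert K V M N m y) ?x"
      by (simp add: tensor_map(2)[OF id(1) ins(2)[OF y]] um)
  qed
qed

section \<open>The tensor product coaction\<close>

lemma (in abelian_group) minus_add_minus:
  assumes "x \<in> carrier G" "x' \<in> carrier G" "y \<in> carrier G" "y' \<in> carrier G"
  shows "(x \<oplus> y) \<ominus> (x' \<oplus> y') = (x \<ominus> x') \<oplus> (y \<ominus> y')"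
  using assms by (simp add: a_minus_def minus_add a_ac)

text \<open>The mixed terms \<open>c\<close> and \<open>c'\<close> have exchanged places in the
  second bracket, which is how the flip leaves them.\<close>

lemma (in abelian_group) mixed_terms_cancel:
  assumes "x \<in> carrier G" "x' \<in> carrier G" "y \<in> carrier G" "y' \<in> carrier G"
    and "c \<in> carrier G" "c' \<in> carrier G"
  shows "((x \<oplus> c) \<oplus> (c' \<oplus> y)) \<ominus> ((x' \<oplus> c') \<oplus> (c \<oplus> y')) = (x \<ominus> x') \<oplus> (y \<ominus> y')"
proof -
  have "((x \<oplus> c) \<oplus> (c' \<oplus> y)) = (x \<oplus> y) \<oplus> (c \<oplus> c')" "((x' \<oplus> c') \<oplus> (c \<oplus> y')) = (x' \<oplus> y') \<oplus> (c \<oplus> c')"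
    using assms by (simp_all add: a_ac)
  then show ?thesis
    using assms minus_add_minus[of "x \<oplus> y" "x' \<oplus> y'" "c \<oplus> c'" "c \<oplus> c'"] minus_add_minus[of x x' y y']
    by (simp add: a_minus_def r_neg)
qed

section \<open>Powers of \<alpha> on the coalgebra leg\<close>

definition leg_pow ::
    "('k, 'r) ring_scheme \<Rightarrow> ('k, 'l, 'e) module_scheme \<Rightarrow> ('l \<Rightarrow> 'l) \<Rightarrow> nat
      \<Rightarrow> ('k, 'm, 'f) module_scheme \<Rightarrow> ('l \<times> 'm \<Rightarrow> 'k) set \<Rightarrow> ('l \<times> 'm \<Rightarrow> 'k) set"
  where "leg_pow K L \<alpha> k M = tensor_map K L L M M (\<alpha> ^^ k) id"

lemma leg_pow_linear:
  assumes "linear_map K L L \<alpha>" "vectorspace K M"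
  shows "linear_map K (L \<boxtimes>\<^bsub>K\<^esub> M) (L \<boxtimes>\<^bsub>K\<^esub> M) (leg_pow K L \<alpha> k M)"
  unfolding leg_pow_def by (rule tensor_map(1)[OF linear_map_funpow linear_map_id']) fact+

text \<open>Kept generic in \<open>w\<close> because both structure maps need it: for
  \<open>\<gamma>\<close> the hypothesis \<open>wa\<close> is a coalgebra axiom, for
  \<open>\<Delta>\<close> it is comultiplicativity.\<close>

lemma comultiplicative_funpow:
  assumes a: "linear_map K L L \<alpha>" and w: "linear_map K L (L \<boxtimes>\<^bsub>K\<^esub> L) w"
    and wa: "\<And>x. x \<in> carrier L \<Longrightarrow> w (\<alpha> x) = tensor_map K L L L L \<alpha> \<alpha> (w x)"
    and x: "x \<in> carrier L"
  shows "w ((\<alpha> ^^ k) x) = tensor_map K L L L L (\<alpha> ^^ k) (\<alpha> ^^ k) (w x)"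
proof (induction k)
  case 0
  have "tensor_map K L L L L (\<lambda>x. x) (\<lambda>x. x) (w x) = w x"
    by (rule tensor_ext[OF tensor_map(1) linear_map_id])
      (simp_all add: linear_map_id linear_mapD[OF a] linear_mapD(3)[OF w] x tensor_map(2)
        tensor_space_vectorspace)
  then show ?case by (simp add: id_def)
next
  case (Suc k)
  note p = linear_map_funpow[OF a, of k]
  show ?case
    using tensor_map_compose[OF p a p a linear_mapD(3)[OF w x]]
    by (simp add: wa linear_mapD(3)[OF p] x Suc o_def)
qed

text \<open>When \<open>w\<close> splits the leg, the power on it is copied to both halves. In
  right-nested form \<open>\<alpha>^k \<otimes> \<alpha>^k \<otimes> Id\<close> is
  \<open>\<alpha>^k\<close> tensored with \<open>leg_pow\<close>.\<close>

lemma leg_pow_assoc: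
  assumes a: "linear_map K L L \<alpha>" and b: "linear_map K M M b"
    and w: "linear_map K L (L \<boxtimes>\<^bsub>K\<^esub> L) w"
    and wa: "\<And>x. x \<in> carrier L \<Longrightarrow> w (\<alpha> x) = tensor_map K L L L L \<alpha> \<alpha> (w x)"
    and x: "x \<in> carrier (L \<boxtimes>\<^bsub>K\<^esub> M)"
  shows "tensor_assoc_right K L L M (tensor_map K L (L \<boxtimes>\<^bsub>K\<^esub> L) M M w b (leg_pow K L \<alpha> k M x))
    = tensor_map K L L (L \<boxtimes>\<^bsub>K\<^esub> M) (L \<boxtimes>\<^bsub>K\<^esub> M) (\<alpha> ^^ k) (leg_pow K L \<alpha> k M)
        (tensor_assoc_right K L L M (tensor_map K L (L \<boxtimes>\<^bsub>K\<^esub> L) M M w b x))"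
proof -
  note p = linear_map_funpow[OF a, of k]
  note vs = linear_mapD(1)[OF a] linear_mapD(1)[OF b]
  note as = tensor_assoc_right(1)[OF vs(1,1,2)] and wb = tensor_map[OF w b]
  note leg = leg_pow_linear[OF a vs(2), of k]
  note id = linear_map_id'[OF vs(2)]
  show ?thesis
  proof (rule tensor_ext[OF linear_map_compose[OF as linear_map_compose[OF wb(1) leg]]
        linear_map_compose[OF tensor_map(1)[OF p leg] linear_map_compose[OF as wb(1)]] vs _ x])
    fix l m assume lm: "l \<in> carrier L" "m \<in> carrier M"
    show "tensor_assoc_right K L L M (tensor_map K L (L \<boxtimes>\<^bsub>K\<^esub> L) M M w b
        (leg_pow K L \<alpha> k M (pure_tensor K L M l m)))
      = tensor_map K L L (L \<boxtimes>\<^bsub>K\<^esub> M) (L \<boxtimes>\<^bsub>K\<^esub> M) (\<alpha> ^^ k) (leg_pow K L \<alpha> k M)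
        (tensor_assoc_right K L L M (tensor_map K L (L \<boxtimes>\<^bsub>K\<^esub> L) M M w b (pure_tensor K L M l m)))"
      using tensor_assoc_right_natural[OF p p id linear_mapD(3)[OF w lm(1)]
          linear_mapD(3)[OF b lm(2)]]
      by (simp add: lm wb(2) leg_pow_def tensor_map(2)[OF p id] linear_mapD(3)[OF p]
          comultiplicative_funpow[OF a w wa])
  qed
qed

lemma leg_pow_map:
  assumes a: "linear_map K L L \<alpha>" and b: "linear_map K M M b" and x: "x \<in> carrier (L \<boxtimes>\<^bsub>K\<^esub> M)"
  shows "tensor_map K L L M M \<alpha> b (leg_pow K L \<alpha> k M x)
    = leg_pow K L \<alpha> k M (tensor_map K L L M M \<alpha> b x)"
proof -
  note p = linear_map_funpow[OF a, of k] and id = linear_map_id'[OF linear_mapD(1)[OF b]]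
  show ?thesis
    unfolding leg_pow_def
    by (simp add: tensor_map_compose[OF p a id b x] tensor_map_compose[OF a p b id x] funpow_swap1)
qed

text \<open>Each of the two coactions brings one power, on its own leg, and \<open>\<alpha>\<close>
  commutes with its powers on the outer leg. The outcome is the twist already found in
  \<open>leg_pow_assoc\<close>, so both sides of a comodule identity are images under the same
  map.\<close>

lemma leg_pow_coaction:
  assumes a: "linear_map K L L \<alpha>" and X: "linear_map K M (L \<boxtimes>\<^bsub>K\<^esub> M) X"
    and x: "x \<in> carrier (L \<boxtimes>\<^bsub>K\<^esub> M)"
  shows "tensor_map K L L M (L \<boxtimes>\<^bsub>K\<^esub> M) \<alpha> (\<lambda>m. leg_pow K L \<alpha> k M (X m)) (leg_pow K L \<alpha> k M x)
    = tensor_map K L L (L \<boxtimes>\<^bsub>K\<^esub> M) (L \<boxtimes>\<^bsub>K\<^esub> M) (\<alpha> ^^ k) (leg_pow K L \<alpha> k M)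
        (tensor_map K L L M (L \<boxtimes>\<^bsub>K\<^esub> M) \<alpha> X x)"
proof -
  note p = linear_map_funpow[OF a, of k] and id = linear_map_id'[OF linear_mapD(1)[OF X]]
  note leg = leg_pow_linear[OF a linear_mapD(1)[OF X], of k]
  note lX = linear_map_compose[OF leg X]
  show ?thesis
    using tensor_map_compose[OF p a id lX x] tensor_map_compose[OF a p X leg x]
    by (simp add: funpow_swap1 leg_pow_def[of K L \<alpha> k M])
qed

section \<open>Coactions on a tensor product of two spaces\<close>

text \<open>Only the linear maps \<open>\<alpha>\<close>, \<open>\<alpha>1\<close>,
  \<open>\<alpha>2\<close> are fixed. The coactions stay arguments of \<open>co\<close>, so that
  each lemma can be used for the diamond and the bullet coaction and for composites of one with the
  other.\<close>

locale tensor_coaction_pair =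
  fixes K (structure) and L and \<alpha> and k :: nat and M1 and \<alpha>1 and M2 and \<alpha>2
  assumes a: "linear_map K L L \<alpha>" and a1: "linear_map K M1 M1 \<alpha>1" and a2: "linear_map K M2 M2 \<alpha>2"
begin

abbreviation "M \<equiv> M1 \<boxtimes> M2"
abbreviation "aM \<equiv> tensor_map K M1 M1 M2 M2 \<alpha>1 \<alpha>2"
abbreviation "co \<equiv> \<lambda>X1 X2. tensor_coaction K L \<alpha> k M1 X1 \<alpha>1 M2 X2 \<alpha>2"
abbreviation "app \<equiv> tensor_append K L M1 M2"
abbreviation "ins \<equiv> tensor_insert K L M1 M2"
abbreviation "leg1 \<equiv> leg_pow K L \<alpha> k M1"
abbreviation "leg2 \<equiv> leg_pow K L \<alpha> k M2"
text \<open>Primes mark the versions for tensors with two legs in \<open>L\<close>, as they arise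
  after two coactions.\<close>

abbreviation "app' \<equiv> \<lambda>n. tensor_map K L L (L \<boxtimes> M1) (L \<boxtimes> M) id (app n)"
abbreviation "ins' \<equiv> \<lambda>m. tensor_map K L L (L \<boxtimes> M2) (L \<boxtimes> M) id (ins m)"
abbreviation "leg1' \<equiv> tensor_map K L L (L \<boxtimes> M1) (L \<boxtimes> M1) (\<alpha> ^^ k) leg1"
abbreviation "leg2' \<equiv> tensor_map K L L (L \<boxtimes> M2) (L \<boxtimes> M2) (\<alpha> ^^ k) leg2"
abbreviation "flip \<equiv> tensor_flip_id K L L M"

lemmas vs = linear_mapD(1)[OF a] linear_mapD(1)[OF a1] linear_mapD(1)[OF a2]
  tensor_space_vectorspace[OF linear_mapD(1)[OF a1] linear_mapD(1)[OF a2]]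

lemmas ids = linear_map_id'[OF vs(1)] linear_map_id'[OF vs(2)] linear_map_id'[OF vs(3)]
lemmas app = tensor_append[OF vs(1-3)]
lemmas ins = tensor_insert[OF vs(1-3)]
lemmas leg1 = leg_pow_linear[OF a vs(2), of k]
lemmas leg2 = leg_pow_linear[OF a vs(3), of k]
lemmas app' = tensor_map[OF ids(1) app(1)]
lemmas ins' = tensor_map[OF ids(1) ins(1)]
lemmas leg1' = tensor_map(1)[OF linear_map_funpow[OF a, of k] leg1]
lemmas leg2' = tensor_map(1)[OF linear_map_funpow[OF a, of k] leg2]
lemmas aM = tensor_map[OF a1 a2]
lemmas flip = tensor_flip_id[OF vs(1,1,4)]
lemmas closed = linear_mapD(3)[OF a] linear_mapD(3)[OF a1] linear_mapD(3)[OF a2]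
  linear_mapD(3)[OF leg1] linear_mapD(3)[OF leg2] linear_mapD(3)[OF aM(1)]

lemma co_linear:
  assumes X1: "linear_map K M1 (L \<boxtimes> M1) X1" and X2: "linear_map K M2 (L \<boxtimes> M2) X2"
  shows "linear_map K M (L \<boxtimes> M) (co X1 X2)"
  unfolding tensor_coaction_def o_def leg_pow_def[symmetric]
  by (intro linear_map_plus linear_map_compose[OF tensor_assoc_right(1)[OF vs(1-3)]]
      linear_map_compose[OF tensor_flip_id(1)[OF vs(2,1,3)]]
      tensor_map(1) linear_map_compose[OF leg1 X1] linear_map_compose[OF leg2 X2] a1 a2)

lemma co_pure:
  assumes X1: "linear_map K M1 (L \<boxtimes> M1) X1" and X2: "linear_map K M2 (L \<boxtimes> M2) X2"
    and m: "m \<in> carrier M1" and n: "n \<in> carrier M2"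
  shows "co X1 X2 (pure_tensor K M1 M2 m n)
    = app (\<alpha>2 n) (leg1 (X1 m)) \<oplus>\<^bsub>L \<boxtimes> M\<^esub> ins (\<alpha>1 m) (leg2 (X2 n))"
  by (simp add: tensor_coaction_def o_def leg_pow_def[symmetric] m n tensor_append_def
      tensor_insert_def tensor_map(2)[OF linear_map_compose[OF leg1 X1] a2]
      tensor_map(2)[OF a1 linear_map_compose[OF leg2 X2]])

text \<open>Naturality of appending and inserting moves the maps onto the factors; there (a) holds
  by \<open>c1\<close> and \<open>c2\<close>, and \<open>\<alpha>\<close> commutes with its
  powers.\<close>

lemma map_alpha_co:
  assumes X1: "linear_map K M1 (L \<boxtimes> M1) X1" and X2: "linear_map K M2 (L \<boxtimes> M2) X2"
    and c1: "\<And>m. m \<in> carrier M1 \<Longrightarrow> X1 (\<alpha>1 m) = tensor_map K L L M1 M1 \<alpha> \<alpha>1 (X1 m)"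
    and c2: "\<And>n. n \<in> carrier M2 \<Longrightarrow> X2 (\<alpha>2 n) = tensor_map K L L M2 M2 \<alpha> \<alpha>2 (X2 n)"
    and t: "t \<in> carrier M"
  shows "co X1 X2 (aM t) = tensor_map K L L M M \<alpha> aM (co X1 X2 t)"
proof -
  note co = co_linear[OF X1 X2] and T = tensor_map(1)[OF a aM(1)]
  note X = linear_mapD(3)[OF X1] linear_mapD(3)[OF X2]
  show ?thesis
  proof (rule tensor_ext[OF linear_map_compose[OF co aM(1)] linear_map_compose[OF T co] vs(2,3) _ t])
    fix m n assume mn: "m \<in> carrier M1" "n \<in> carrier M2"
    show "co X1 X2 (aM (pure_tensor K M1 M2 m n))
      = tensor_map K L L M M \<alpha> aM (co X1 X2 (pure_tensor K M1 M2 m n))"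
      by (simp add: mn aM(2) co_pure[OF X1 X2] closed X linear_mapD(4)[OF T]
          linear_mapD(3)[OF app(1)] linear_mapD(3)[OF ins(1)] tensor_append_natural[OF a a1 a2]
          tensor_insert_natural[OF a a1 a2] leg_pow_map[OF a a1] leg_pow_map[OF a a2] c1 c2)
  qed
qed

text \<open>The map \<open>w\<close> sees only the leg and \<open>aM\<close> acts factorwise, so the
  appended vector merely acquires \<open>\<alpha>2\<close>; the pentagon identity then moves it
  outside.\<close>

lemma assoc_map_app:
  assumes w: "linear_map K L (L \<boxtimes> L) w" and n: "n \<in> carrier M2" and x: "x \<in> carrier (L \<boxtimes> M1)"
  shows "tensor_assoc_right K L L M (tensor_map K L (L \<boxtimes> L) M M w aM (app n x))
    = app' (\<alpha>2 n) (tensor_assoc_right K L L M1 (tensor_map K L (L \<boxtimes> L) M1 M1 w \<alpha>1 x))"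
proof -
  note as = tensor_assoc_right(1)[OF vs(1,1,4)] tensor_assoc_right(1)[OF vs(1,1,2)]
  note W = tensor_map[OF w aM(1)] and W1 = tensor_map[OF w a1]
  note n' = closed(3)[OF n]
  show ?thesis
    \<comment> \<open>The pentagon rule is unfolded only for appends onto
      \<open>L \<boxtimes> L\<close>. This exposes the associators of the goal while
      \<open>app\<close> stays folded.\<close>
    by (rule tensor_ext[OF linear_map_compose[OF as(1) linear_map_compose[OF W(1) app(1)[OF n]]]
          linear_map_compose[OF app'(1)[OF n'] linear_map_compose[OF as(2) W1(1)]] vs(1,2) _ x])
      (simp add: n app(3) W(2) W1(2) aM(2) pure_tensor_closed vs linear_mapD(3)[OF w] closed
        tensor_append_assoc[OF vs(1,1,2,3), unfolded tensor_append_def[of K L L]])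
qed

lemma assoc_map_ins:
  assumes w: "linear_map K L (L \<boxtimes> L) w" and m: "m \<in> carrier M1" and x: "x \<in> carrier (L \<boxtimes> M2)"
  shows "tensor_assoc_right K L L M (tensor_map K L (L \<boxtimes> L) M M w aM (ins m x))
    = ins' (\<alpha>1 m) (tensor_assoc_right K L L M2 (tensor_map K L (L \<boxtimes> L) M2 M2 w \<alpha>2 x))"
proof -
  note as = tensor_assoc_right(1)[OF vs(1,1,4)] tensor_assoc_right(1)[OF vs(1,1,3)]
  note W = tensor_map[OF w aM(1)] and W1 = tensor_map[OF w a2]
  note m' = closed(2)[OF m]
  show ?thesis
    by (rule tensor_ext[OF linear_map_compose[OF as(1) linear_map_compose[OF W(1) ins(1)[OF m]]]
          linear_map_compose[OF ins'(1)[OF m'] linear_map_compose[OF as(2) W1(1)]] vs(1,3) _ x])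
      (simp add: m ins(3) W(2) W1(2) aM(2) pure_tensor_closed vs linear_mapD(3)[OF w] closed
        tensor_insert_assoc[OF vs(1,1,2,3), unfolded tensor_append_def[of K L L]])
qed

text \<open>Only one coaction is involved, hence no mixed terms. In
  \<open>\<alpha>2 (\<alpha>2 n)\<close> one \<open>\<alpha>2\<close> comes from the coaction and
  the other from \<open>aM\<close>.\<close>

lemma assoc_map_co:
  assumes w: "linear_map K L (L \<boxtimes> L) w"
    and wa: "\<And>x. x \<in> carrier L \<Longrightarrow> w (\<alpha> x) = tensor_map K L L L L \<alpha> \<alpha> (w x)"
    and X1: "linear_map K M1 (L \<boxtimes> M1) X1" and X2: "linear_map K M2 (L \<boxtimes> M2) X2"
    and m: "m \<in> carrier M1" and n: "n \<in> carrier M2"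
  shows "tensor_assoc_right K L L M (tensor_map K L (L \<boxtimes> L) M M w aM
      (co X1 X2 (pure_tensor K M1 M2 m n)))
    = app' (\<alpha>2 (\<alpha>2 n)) (leg1'
        (tensor_assoc_right K L L M1 (tensor_map K L (L \<boxtimes> L) M1 M1 w \<alpha>1 (X1 m))))
      \<oplus>\<^bsub>L \<boxtimes> L \<boxtimes> M\<^esub> ins' (\<alpha>1 (\<alpha>1 m)) (leg2'
        (tensor_assoc_right K L L M2 (tensor_map K L (L \<boxtimes> L) M2 M2 w \<alpha>2 (X2 n))))"
proof -
  note T = linear_map_compose[OF tensor_assoc_right(1)[OF vs(1,1,4)] tensor_map(1)[OF w aM(1)]]
  show ?thesis
    by (simp add: co_pure[OF X1 X2 m n] linear_mapD(4)[OF T] closed m n linear_mapD(3)[OF X1]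
        linear_mapD(3)[OF X2] linear_mapD(3)[OF app(1)] linear_mapD(3)[OF ins(1)]
        assoc_map_app[OF w] assoc_map_ins[OF w] leg_pow_assoc[OF a a1 w wa] leg_pow_assoc[OF a a2 w wa])
qed

section \<open>Composites of two coactions and their mixed terms\<close>

text \<open>The two maps differ only in the order of the legs: in \<open>mix\<close> the leg of
  \<open>x\<close> stands first, in \<open>mix'\<close> that of \<open>y\<close>.\<close>

abbreviation "mix \<equiv> \<lambda>x y. tensor_map K L L M1 (L \<boxtimes> M) id (\<lambda>m. ins m y) x"
abbreviation "mix' \<equiv> \<lambda>x y. tensor_map K L L M2 (L \<boxtimes> M) id (\<lambda>n. app n x) y"

text \<open>Here \<open>x\<close> is the result of an earlier coaction on the first factor. The next
  one acts either on that factor again, which is the unmixed term, or on the untouched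
  \<open>n\<close>, which yields the mixed one.\<close>

lemma map_co_app:
  assumes X1: "linear_map K M1 (L \<boxtimes> M1) X1" and X2: "linear_map K M2 (L \<boxtimes> M2) X2"
    and n: "n \<in> carrier M2" and x: "x \<in> carrier (L \<boxtimes> M1)"
  shows "tensor_map K L L M (L \<boxtimes> M) \<alpha> (co X1 X2) (app n x)
    = app' (\<alpha>2 n) (tensor_map K L L M1 (L \<boxtimes> M1) \<alpha> (\<lambda>m. leg1 (X1 m)) x)
      \<oplus>\<^bsub>L \<boxtimes> L \<boxtimes> M\<^esub> mix (tensor_map K L L M1 M1 \<alpha> \<alpha>1 x) (leg2 (X2 n))"
proof -
  note T = tensor_map[OF a co_linear[OF X1 X2]]
  note lX = linear_map_compose[OF leg1 X1]
  note S = tensor_map[OF a lX] and R = tensor_map[OF a a1]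
  have y: "leg2 (X2 n) \<in> carrier (L \<boxtimes> M2)" by (simp add: closed linear_mapD(3)[OF X2] n)
  note Q = tensor_map[OF ids(1) ins(2)[OF y]]
  note n' = closed(3)[OF n]
  show ?thesis
  proof (rule tensor_ext[OF linear_map_compose[OF T(1) app(1)[OF n]]
        linear_map_plus[OF linear_map_compose[OF app'(1)[OF n'] S(1)] linear_map_compose[OF Q(1) R(1)]]
        vs(1,2) _ x])
    fix l m assume lm: "l \<in> carrier L" "m \<in> carrier M1"
    have "app (\<alpha>2 n) (leg1 (X1 m)) \<in> carrier (L \<boxtimes> M)" "ins (\<alpha>1 m) (leg2 (X2 n)) \<in> carrier (L \<boxtimes> M)"
      by (simp_all add: closed lm n linear_mapD(3)[OF X1] linear_mapD(3)[OF X2]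
        linear_mapD(3)[OF app(1)] linear_mapD(3)[OF ins(1)])
    \<comment> \<open>On a pure tensor the two summands of the coaction appear inside the second
      slot; additivity of that slot separates them.\<close>
    note add = linear_mapD(4)[OF linear_map_pure_right[OF vs(1) closed(1)[OF lm(1)] linear_map_id
          [OF tensor_space_vectorspace[OF vs(1,4)]]] this]
    show "tensor_map K L L M (L \<boxtimes> M) \<alpha> (co X1 X2) (app n (pure_tensor K L M1 l m))
      = app' (\<alpha>2 n) (tensor_map K L L M1 (L \<boxtimes> M1) \<alpha> (\<lambda>m. leg1 (X1 m)) (pure_tensor K L M1 l m))
        \<oplus>\<^bsub>L \<boxtimes> L \<boxtimes> M\<^esub> mix (tensor_map K L L M1 M1 \<alpha> \<alpha>1 (pure_tensor K L M1 l m)) (leg2 (X2 n))"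
      by (simp add: lm n closed app(3) T(2) pure_tensor_closed vs co_pure[OF X1 X2] S(2) R(2) Q(2)
          app'(2) linear_mapD(3)[OF X1] add)
  qed
qed

lemma map_co_ins:
  assumes X1: "linear_map K M1 (L \<boxtimes> M1) X1" and X2: "linear_map K M2 (L \<boxtimes> M2) X2"
    and m: "m \<in> carrier M1" and y: "y \<in> carrier (L \<boxtimes> M2)"
  shows "tensor_map K L L M (L \<boxtimes> M) \<alpha> (co X1 X2) (ins m y)
    = mix' (leg1 (X1 m)) (tensor_map K L L M2 M2 \<alpha> \<alpha>2 y)
      \<oplus>\<^bsub>L \<boxtimes> L \<boxtimes> M\<^esub> ins' (\<alpha>1 m) (tensor_map K L L M2 (L \<boxtimes> M2) \<alpha> (\<lambda>n. leg2 (X2 n)) y)"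
proof -
  note T = tensor_map[OF a co_linear[OF X1 X2]]
  note lX = linear_map_compose[OF leg2 X2]
  note S = tensor_map[OF a lX] and R = tensor_map[OF a a2]
  have x: "leg1 (X1 m) \<in> carrier (L \<boxtimes> M1)" by (simp add: closed linear_mapD(3)[OF X1] m)
  note P = tensor_map[OF ids(1) app(2)[OF x]]
  note m' = closed(2)[OF m]
  show ?thesis
  proof (rule tensor_ext[OF linear_map_compose[OF T(1) ins(1)[OF m]]
        linear_map_plus[OF linear_map_compose[OF P(1) R(1)] linear_map_compose[OF ins'(1)[OF m'] S(1)]]
        vs(1,3) _ y])
    fix l n assume ln: "l \<in> carrier L" "n \<in> carrier M2"
    have "app (\<alpha>2 n) (leg1 (X1 m)) \<in> carrier (L \<boxtimes> M)" "ins (\<alpha>1 m) (leg2 (X2 n)) \<in> carrier (L \<boxtimes> M)"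
      by (simp_all add: closed ln m linear_mapD(3)[OF X1] linear_mapD(3)[OF X2]
        linear_mapD(3)[OF app(1)] linear_mapD(3)[OF ins(1)])
    note add = linear_mapD(4)[OF linear_map_pure_right[OF vs(1) closed(1)[OF ln(1)] linear_map_id
          [OF tensor_space_vectorspace[OF vs(1,4)]]] this]
    show "tensor_map K L L M (L \<boxtimes> M) \<alpha> (co X1 X2) (ins m (pure_tensor K L M2 l n))
      = mix' (leg1 (X1 m)) (tensor_map K L L M2 M2 \<alpha> \<alpha>2 (pure_tensor K L M2 l n))
        \<oplus>\<^bsub>L \<boxtimes> L \<boxtimes> M\<^esub> ins' (\<alpha>1 m) (tensor_map K L L M2 (L \<boxtimes> M2) \<alpha> (\<lambda>n. leg2 (X2 n))
          (pure_tensor K L M2 l n))"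
      by (simp add: ln m closed ins(3) T(2) pure_tensor_closed vs co_pure[OF X1 X2] S(2) R(2) P(2)
          ins'(2) linear_mapD(3)[OF X2] add)
  qed
qed

text \<open>The common normal form of mixed arguments: \<open>leg1 (X1 (\<alpha>1 m))\<close>
  reaches it by (a), and \<open>\<alpha> \<otimes> \<alpha>1\<close> applied to
  \<open>leg1 (X1 m)\<close> reaches it by \<open>leg_pow_map\<close>.\<close>

abbreviation "ev1 \<equiv> \<lambda>x. leg1 (tensor_map K L L M1 M1 \<alpha> \<alpha>1 x)"
abbreviation "ev2 \<equiv> \<lambda>y. leg2 (tensor_map K L L M2 M2 \<alpha> \<alpha>2 y)"

text \<open>In every term the leg of the coaction applied first, Y, stands outermost. Thus
  \<open>mix\<close> comes from Y on \<open>M1\<close> followed by X on \<open>M2\<close>, and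
  \<open>mix'\<close> from Y on \<open>M2\<close> followed by X on \<open>M1\<close>.\<close>

lemma map_co_co:
  assumes X1: "linear_map K M1 (L \<boxtimes> M1) X1" and X2: "linear_map K M2 (L \<boxtimes> M2) X2"
    and c1: "\<And>m. m \<in> carrier M1 \<Longrightarrow> X1 (\<alpha>1 m) = tensor_map K L L M1 M1 \<alpha> \<alpha>1 (X1 m)"
    and c2: "\<And>n. n \<in> carrier M2 \<Longrightarrow> X2 (\<alpha>2 n) = tensor_map K L L M2 M2 \<alpha> \<alpha>2 (X2 n)"
    and Y1: "linear_map K M1 (L \<boxtimes> M1) Y1" and Y2: "linear_map K M2 (L \<boxtimes> M2) Y2"
    and m: "m \<in> carrier M1" and n: "n \<in> carrier M2"
  shows "tensor_map K L L M (L \<boxtimes> M) \<alpha> (co X1 X2) (co Y1 Y2 (pure_tensor K M1 M2 m n))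
    = (app' (\<alpha>2 (\<alpha>2 n)) (leg1' (tensor_map K L L M1 (L \<boxtimes> M1) \<alpha> X1 (Y1 m)))
        \<oplus>\<^bsub>L \<boxtimes> L \<boxtimes> M\<^esub> mix (ev1 (Y1 m)) (ev2 (X2 n)))
      \<oplus>\<^bsub>L \<boxtimes> L \<boxtimes> M\<^esub> (mix' (ev1 (X1 m)) (ev2 (Y2 n))
        \<oplus>\<^bsub>L \<boxtimes> L \<boxtimes> M\<^esub> ins' (\<alpha>1 (\<alpha>1 m)) (leg2' (tensor_map K L L M2 (L \<boxtimes> M2) \<alpha> X2 (Y2 n))))"
proof -
  note T = tensor_map(1)[OF a co_linear[OF X1 X2]]
  show ?thesis
    by (simp add: co_pure[OF Y1 Y2 m n] linear_mapD(4)[OF T] closed m n linear_mapD(3)[OF Y1]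
        linear_mapD(3)[OF Y2] linear_mapD(3)[OF app(1)] linear_mapD(3)[OF ins(1)]
        map_co_app[OF X1 X2] map_co_ins[OF X1 X2] c1 c2 leg_pow_map[OF a a1] leg_pow_map[OF a a2]
        leg_pow_coaction[OF a X1] leg_pow_coaction[OF a X2])
qed

text \<open>The two exchanged legs carry the same power of \<open>\<alpha>\<close>, and the new
  factor lies behind both.\<close>

lemma flip_app':
  assumes n: "n \<in> carrier M2" and x: "x \<in> carrier (L \<boxtimes> L \<boxtimes> M1)"
  shows "flip (app' n (leg1' x)) = app' n (leg1' (tensor_flip_id K L L M1 x))"
  using tensor_flip_id_natural[OF linear_map_funpow[OF a] linear_map_funpow[OF a] ids(2) x]
    tensor_flip_id_map_append[OF vs(1,1,2,3) n linear_mapD(3)[OF leg1' x]]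
  by (simp add: leg_pow_def)

lemma flip_ins':
  assumes m: "m \<in> carrier M1" and y: "y \<in> carrier (L \<boxtimes> L \<boxtimes> M2)"
  shows "flip (ins' m (leg2' y)) = ins' m (leg2' (tensor_flip_id K L L M2 y))"
  using tensor_flip_id_natural[OF linear_map_funpow[OF a] linear_map_funpow[OF a] ids(3) y]
    tensor_flip_id_map_insert[OF vs(1,1,2,3) m linear_mapD(3)[OF leg2' y]]
  by (simp add: leg_pow_def)

lemma mix'_closed:
  assumes x: "x \<in> carrier (L \<boxtimes> M1)" and y: "y \<in> carrier (L \<boxtimes> M2)"
  shows "mix' x y \<in> carrier (L \<boxtimes> L \<boxtimes> M)"
  using linear_mapD(3)[OF tensor_map(1)[OF ids(1) app(2)[OF x]] y] .

lemma flip_mix':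
  assumes x: "x \<in> carrier (L \<boxtimes> M1)" and y: "y \<in> carrier (L \<boxtimes> M2)"
  shows "flip (mix' x y) = mix x y" "flip (mix x y) = mix' x y"
proof -
  show *: "flip (mix' x y) = mix x y" by (rule tensor_flip_id_mixed[OF vs(1,1,2,3) x y])
  show "flip (mix x y) = mix' x y"
    using tensor_flip_id_involution[OF vs(1,1,4) mix'_closed[OF x y]] by (simp add: *)
qed

text \<open>Interchanging X and Y and then flipping reproduces both mixed terms: the flip sends
  \<open>mix (ev1 (X1 m)) (ev2 (Y2 n))\<close> to the \<open>mix'\<close> term of the first
  composite, and likewise for the other pair.\<close>

lemma map_co_co_minus:
  assumes X1: "linear_map K M1 (L \<boxtimes> M1) X1" and X2: "linear_map K M2 (L \<boxtimes> M2) X2"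
    and X1a: "\<And>m. m \<in> carrier M1 \<Longrightarrow> X1 (\<alpha>1 m) = tensor_map K L L M1 M1 \<alpha> \<alpha>1 (X1 m)"
    and X2a: "\<And>n. n \<in> carrier M2 \<Longrightarrow> X2 (\<alpha>2 n) = tensor_map K L L M2 M2 \<alpha> \<alpha>2 (X2 n)"
    and Y1: "linear_map K M1 (L \<boxtimes> M1) Y1" and Y2: "linear_map K M2 (L \<boxtimes> M2) Y2"
    and Y1a: "\<And>m. m \<in> carrier M1 \<Longrightarrow> Y1 (\<alpha>1 m) = tensor_map K L L M1 M1 \<alpha> \<alpha>1 (Y1 m)"
    and Y2a: "\<And>n. n \<in> carrier M2 \<Longrightarrow> Y2 (\<alpha>2 n) = tensor_map K L L M2 M2 \<alpha> \<alpha>2 (Y2 n)"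
    and m: "m \<in> carrier M1" and n: "n \<in> carrier M2"
  shows "tensor_map K L L M (L \<boxtimes> M) \<alpha> (co X1 X2) (co Y1 Y2 (pure_tensor K M1 M2 m n))
      \<ominus>\<^bsub>L \<boxtimes> L \<boxtimes> M\<^esub>
      flip (tensor_map K L L M (L \<boxtimes> M) \<alpha> (co Y1 Y2) (co X1 X2 (pure_tensor K M1 M2 m n)))
    = app' (\<alpha>2 (\<alpha>2 n)) (leg1' (tensor_map K L L M1 (L \<boxtimes> M1) \<alpha> X1 (Y1 m)
        \<ominus>\<^bsub>L \<boxtimes> L \<boxtimes> M1\<^esub> tensor_flip_id K L L M1 (tensor_map K L L M1 (L \<boxtimes> M1) \<alpha> Y1 (X1 m))))
      \<oplus>\<^bsub>L \<boxtimes> L \<boxtimes> M\<^esub>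
      ins' (\<alpha>1 (\<alpha>1 m)) (leg2' (tensor_map K L L M2 (L \<boxtimes> M2) \<alpha> X2 (Y2 n)
        \<ominus>\<^bsub>L \<boxtimes> L \<boxtimes> M2\<^esub> tensor_flip_id K L L M2 (tensor_map K L L M2 (L \<boxtimes> M2) \<alpha> Y2 (X2 n))))"
proof -
  interpret T: vectorspace K "L \<boxtimes> L \<boxtimes> M" by (intro tensor_space_vectorspace vs)
  let ?p = "\<lambda>x. app' (\<alpha>2 (\<alpha>2 n)) (leg1' x)" and ?q = "\<lambda>y. ins' (\<alpha>1 (\<alpha>1 m)) (leg2' y)"
  note p = linear_map_compose[OF app'(1)[OF closed(3)[OF closed(3)[OF n]]] leg1']
  note q = linear_map_compose[OF ins'(1)[OF closed(2)[OF closed(2)[OF m]]] leg2']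
  note X = linear_mapD(3)[OF X1 m] linear_mapD(3)[OF X2 n]
  note Y = linear_mapD(3)[OF Y1 m] linear_mapD(3)[OF Y2 n]
  note ax = linear_mapD(3)[OF tensor_map(1)[OF a X1] Y(1)] linear_mapD(3)[OF tensor_map(1)[OF a Y1] X(1)]
    linear_mapD(3)[OF tensor_map(1)[OF a X2] Y(2)] linear_mapD(3)[OF tensor_map(1)[OF a Y2] X(2)]
  have ev: "ev1 (X1 m) \<in> carrier (L \<boxtimes> M1)" "ev1 (Y1 m) \<in> carrier (L \<boxtimes> M1)"
      "ev2 (X2 n) \<in> carrier (L \<boxtimes> M2)" "ev2 (Y2 n) \<in> carrier (L \<boxtimes> M2)"
    using X Y by (simp_all add: linear_mapD(3)[OF linear_map_compose[OF leg1 tensor_map(1)[OF a a1]]]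
        linear_mapD(3)[OF linear_map_compose[OF leg2 tensor_map(1)[OF a a2]]])
  note mc = mix'_closed[OF ev(1,3)] mix'_closed[OF ev(1,4)] mix'_closed[OF ev(2,3)] mix'_closed[OF ev(2,4)]
  have mix: "mix x y \<in> carrier (L \<boxtimes> L \<boxtimes> M)" if "x \<in> carrier (L \<boxtimes> M1)" "y \<in> carrier (L \<boxtimes> M2)" for x y
    using linear_mapD(3)[OF flip(1) mix'_closed[OF that]] flip_mix'(1)[OF that] by simp
  note fl1 = linear_mapD(3)[OF tensor_flip_id(1)[OF vs(1,1,2)]]
  note fl2 = linear_mapD(3)[OF tensor_flip_id(1)[OF vs(1,1,3)]]
  note mc = mc mix[OF ev(1,3)] mix[OF ev(1,4)] mix[OF ev(2,3)] mix[OF ev(2,4)]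
  note pq = linear_mapD(3)[OF p ax(1)] linear_mapD(3)[OF p ax(2)]
    linear_mapD(3)[OF q ax(3)] linear_mapD(3)[OF q ax(4)]
    linear_mapD(3)[OF p fl1[OF ax(2)]] linear_mapD(3)[OF q fl2[OF ax(4)]]
  show ?thesis
    \<comment> \<open>Splitting the differences under \<open>?p\<close> and \<open>?q\<close> brings
      the goal into the shape of \<open>mixed_terms_cancel\<close>.\<close>
    unfolding linear_mapD(5)[OF p ax(1) fl1[OF ax(2)]] linear_mapD(5)[OF q ax(3) fl2[OF ax(4)]]
    using pq mc
    by (simp add: map_co_co[OF X1 X2 X1a X2a Y1 Y2 m n] map_co_co[OF Y1 Y2 Y1a Y2a X1 X2 m n]
        linear_mapD(4)[OF flip(1)] flip_mix' ev flip_app' flip_ins' ax closed m n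
        T.M.mixed_terms_cancel)
qed

end

section \<open>Verification of the comodule axioms\<close>

theorem theorem5p6:
  fixes K :: "('k, 'r) ring_scheme"
    and L :: "('k, 'l, 'le) module_scheme"
    and M1 :: "('k, 'm, 'me) module_scheme"
    and M2 :: "('k, 'n, 'ne) module_scheme"
    and k :: nat
  assumes "comultiplicative_post_hom_lie_coalgebra K L \<gamma> \<Delta> \<alpha>"
    and "post_hom_lie_comodule K L \<gamma> \<Delta> \<alpha> M1 D1 B1 \<alpha>1"
    and "post_hom_lie_comodule K L \<gamma> \<Delta> \<alpha> M2 D2 B2 \<alpha>2"
  shows "post_hom_lie_comodule K L \<gamma> \<Delta> \<alpha> (M1 \<boxtimes>\<^bsub>K\<^esub> M2)
    (tensor_coaction K L \<alpha> k M1 D1 \<alpha>1 M2 D2 \<alpha>2)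
    (tensor_coaction K L \<alpha> k M1 B1 \<alpha>1 M2 B2 \<alpha>2)
    (tensor_map K M1 M1 M2 M2 \<alpha>1 \<alpha>2)"
proof -
  interpret L: comultiplicative_post_hom_lie_coalgebra K L \<gamma> \<Delta> \<alpha> by fact
  interpret C1: post_hom_lie_comodule K L \<gamma> \<Delta> \<alpha> M1 D1 B1 \<alpha>1 by fact
  interpret C2: post_hom_lie_comodule K L \<gamma> \<Delta> \<alpha> M2 D2 B2 \<alpha>2 by fact
  interpret tensor_coaction_pair K L \<alpha> k M1 \<alpha>1 M2 \<alpha>2
    by (rule tensor_coaction_pair.intro) (rule L.alpha_linear C1.alpha_M_linear C2.alpha_M_linear)+
  let ?Z = "L \<boxtimes>\<^bsub>K\<^esub> L \<boxtimes>\<^bsub>K\<^esub> M"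
  interpret Z: vectorspace K ?Z by (intro tensor_space_vectorspace vs)
  note D = co_linear[OF C1.D_linear C2.D_linear]
  note B = co_linear[OF C1.B_linear C2.B_linear]
  note as = tensor_assoc_right(1)[OF vs(1,1,4)]
  note as1 = tensor_assoc_right(1)[OF vs(1,1,2)] and as2 = tensor_assoc_right(1)[OF vs(1,1,3)]
  note fl1 = tensor_flip_id(1)[OF vs(1,1,2)] and fl2 = tensor_flip_id(1)[OF vs(1,1,3)]
  note aD = tensor_map(1)[OF a D] and aB = tensor_map(1)[OF a B]
  note g = tensor_map(1)[OF L.gamma_linear aM(1)] and d = tensor_map(1)[OF L.Delta_linear aM(1)]
  have ga: "\<gamma> (\<alpha> x) = tensor_map K L L L L \<alpha> \<alpha> (\<gamma> x)" if "x \<in> carrier L" for x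
    using L.gamma_alpha[OF that] by simp
  have da: "\<Delta> (\<alpha> x) = tensor_map K L L L L \<alpha> \<alpha> (\<Delta> x)" if "x \<in> carrier L" for x
    using L.Delta_alpha[OF that] by simp
  have D1a: "D1 (\<alpha>1 m) = tensor_map K L L M1 M1 \<alpha> \<alpha>1 (D1 m)"
    and B1a: "B1 (\<alpha>1 m) = tensor_map K L L M1 M1 \<alpha> \<alpha>1 (B1 m)" if "m \<in> carrier M1" for m
    using C1.D_alpha[OF that] C1.B_alpha[OF that] by simp_all
  have D2a: "D2 (\<alpha>2 n) = tensor_map K L L M2 M2 \<alpha> \<alpha>2 (D2 n)"
    and B2a: "B2 (\<alpha>2 n) = tensor_map K L L M2 M2 \<alpha> \<alpha>2 (B2 n)" if "n \<in> carrier M2" for n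
    using C2.D_alpha[OF that] C2.B_alpha[OF that] by simp_all
  note gco = assoc_map_co[OF L.gamma_linear ga] and dco = assoc_map_co[OF L.Delta_linear da]
  show ?thesis
  proof (intro post_hom_lie_comodule.intro post_hom_lie_comodule_axioms.intro
      L.post_hom_lie_coalgebra_axioms vs(4) aM(1) D B)
    fix t assume t: "t \<in> carrier M"
    show "(co D1 D2 \<circ> aM) t = (tensor_map K L L M M \<alpha> aM \<circ> co D1 D2) t"
      using map_alpha_co[OF C1.D_linear C2.D_linear D1a D2a t] by simp
  next
    fix t assume t: "t \<in> carrier M"
    show "(co B1 B2 \<circ> aM) t = (tensor_map K L L M M \<alpha> aM \<circ> co B1 B2) t"
      using map_alpha_co[OF C1.B_linear C2.B_linear B1a B2a t] by simp
  next
    fix t assume t: "t \<in> carrier M"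
    let ?aD = "\<lambda>t. tensor_map K L L M (L \<boxtimes>\<^bsub>K\<^esub> M) \<alpha> (co D1 D2) (co D1 D2 t)"
    have "tensor_assoc_right K L L M (tensor_map K L (L \<boxtimes>\<^bsub>K\<^esub> L) M M \<gamma> aM (co D1 D2 t))
      = ?aD t \<ominus>\<^bsub>?Z\<^esub> flip (?aD t)"
    proof (rule tensor_ext[OF linear_map_compose[OF as linear_map_compose[OF g D]]
          linear_map_minus[OF linear_map_compose[OF aD D]
            linear_map_compose[OF flip(1) linear_map_compose[OF aD D]]] vs(2,3) _ t])
      fix m n assume mn: "m \<in> carrier M1" "n \<in> carrier M2"
      show "tensor_assoc_right K L L M (tensor_map K L (L \<boxtimes>\<^bsub>K\<^esub> L) M M \<gamma> aM
            (co D1 D2 (pure_tensor K M1 M2 m n)))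
        = ?aD (pure_tensor K M1 M2 m n) \<ominus>\<^bsub>?Z\<^esub> flip (?aD (pure_tensor K M1 M2 m n))"
        \<comment> \<open>Both sides become images under the same two maps of composites over
          \<open>M1\<close> and over \<open>M2\<close>; there axiom (b) of the given comodules
          identifies them.\<close>
        using C1.gamma_D[OF mn(1)] C2.gamma_D[OF mn(2)]
        by (simp add: gco[OF _ C1.D_linear C2.D_linear mn]
            map_co_co_minus[OF C1.D_linear C2.D_linear D1a D2a C1.D_linear C2.D_linear D1a D2a mn])
    qed
    then show "(tensor_assoc_right K L L M \<circ> tensor_map K L (L \<boxtimes>\<^bsub>K\<^esub> L) M M \<gamma> aM \<circ> co D1 D2) t
      = (tensor_map K L L M (L \<boxtimes>\<^bsub>K\<^esub> M) \<alpha> (co D1 D2) \<circ> co D1 D2) t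
        \<ominus>\<^bsub>?Z\<^esub> (flip \<circ> tensor_map K L L M (L \<boxtimes>\<^bsub>K\<^esub> M) \<alpha> (co D1 D2) \<circ> co D1 D2) t"
      by simp
  next
    fix t assume t: "t \<in> carrier M"
    let ?DB = "\<lambda>t. tensor_map K L L M (L \<boxtimes>\<^bsub>K\<^esub> M) \<alpha> (co D1 D2) (co B1 B2 t)"
    let ?BD = "\<lambda>t. tensor_map K L L M (L \<boxtimes>\<^bsub>K\<^esub> M) \<alpha> (co B1 B2) (co D1 D2 t)"
    have "tensor_assoc_right K L L M (tensor_map K L (L \<boxtimes>\<^bsub>K\<^esub> L) M M \<Delta> aM (co D1 D2 t))
      = ?DB t \<ominus>\<^bsub>?Z\<^esub> flip (?BD t)"
    proof (rule tensor_ext[OF linear_map_compose[OF as linear_map_compose[OF d D]]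
          linear_map_minus[OF linear_map_compose[OF aD B]
            linear_map_compose[OF flip(1) linear_map_compose[OF aB D]]] vs(2,3) _ t])
      fix m n assume mn: "m \<in> carrier M1" "n \<in> carrier M2"
      show "tensor_assoc_right K L L M (tensor_map K L (L \<boxtimes>\<^bsub>K\<^esub> L) M M \<Delta> aM
            (co D1 D2 (pure_tensor K M1 M2 m n)))
        = ?DB (pure_tensor K M1 M2 m n) \<ominus>\<^bsub>?Z\<^esub> flip (?BD (pure_tensor K M1 M2 m n))"
        using C1.Delta_D[OF mn(1)] C2.Delta_D[OF mn(2)]
        by (simp add: dco[OF _ C1.D_linear C2.D_linear mn]
            map_co_co_minus[OF C1.D_linear C2.D_linear D1a D2a C1.B_linear C2.B_linear B1a B2a mn])
    qed
    then show "(tensor_assoc_right K L L M \<circ> tensor_map K L (L \<boxtimes>\<^bsub>K\<^esub> L) M M \<Delta> aM \<circ> co D1 D2) t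
      = (tensor_map K L L M (L \<boxtimes>\<^bsub>K\<^esub> M) \<alpha> (co D1 D2) \<circ> co B1 B2) t
        \<ominus>\<^bsub>?Z\<^esub> (flip \<circ> tensor_map K L L M (L \<boxtimes>\<^bsub>K\<^esub> M) \<alpha> (co B1 B2) \<circ> co D1 D2) t"
      by simp
  next
    fix t assume t: "t \<in> carrier M"
    let ?BB = "\<lambda>t. tensor_map K L L M (L \<boxtimes>\<^bsub>K\<^esub> M) \<alpha> (co B1 B2) (co B1 B2 t)"
    let ?s = "\<lambda>t. tensor_assoc_right K L L M (tensor_map K L (L \<boxtimes>\<^bsub>K\<^esub> L) M M \<Delta> aM (co B1 B2 t))"
    note s = linear_map_compose[OF as linear_map_compose[OF d B]]
    have "tensor_assoc_right K L L M (tensor_map K L (L \<boxtimes>\<^bsub>K\<^esub> L) M M \<gamma> aM (co B1 B2 t))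
      = (?BB t \<ominus>\<^bsub>?Z\<^esub> flip (?BB t)) \<oplus>\<^bsub>?Z\<^esub> (flip (?s t) \<ominus>\<^bsub>?Z\<^esub> ?s t)"
    proof (rule tensor_ext[OF linear_map_compose[OF as linear_map_compose[OF g B]]
          linear_map_plus[OF linear_map_minus[OF linear_map_compose[OF aB B]
            linear_map_compose[OF flip(1) linear_map_compose[OF aB B]]]
            linear_map_minus[OF linear_map_compose[OF flip(1) s] s]] vs(2,3) _ t])
      fix m n assume mn: "m \<in> carrier M1" "n \<in> carrier M2"
      let ?p = "\<lambda>x. app' (\<alpha>2 (\<alpha>2 n)) (leg1' x)" and ?q = "\<lambda>y. ins' (\<alpha>1 (\<alpha>1 m)) (leg2' y)"
      let ?t = "pure_tensor K M1 M2 m n"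
      let ?t1 = "tensor_map K L L M1 (L \<boxtimes>\<^bsub>K\<^esub> M1) \<alpha> B1 (B1 m)"
        and ?t2 = "tensor_map K L L M2 (L \<boxtimes>\<^bsub>K\<^esub> M2) \<alpha> B2 (B2 n)"
        and ?s1 = "tensor_assoc_right K L L M1 (tensor_map K L (L \<boxtimes>\<^bsub>K\<^esub> L) M1 M1 \<Delta> \<alpha>1 (B1 m))"
        and ?s2 = "tensor_assoc_right K L L M2 (tensor_map K L (L \<boxtimes>\<^bsub>K\<^esub> L) M2 M2 \<Delta> \<alpha>2 (B2 n))"
      let ?f1 = "tensor_flip_id K L L M1" and ?f2 = "tensor_flip_id K L L M2"
      let ?u1 = "?t1 \<ominus>\<^bsub>L \<boxtimes>\<^bsub>K\<^esub> L \<boxtimes>\<^bsub>K\<^esub> M1\<^esub> ?f1 ?t1" and ?u2 = "?t2 \<ominus>\<^bsub>L \<boxtimes>\<^bsub>K\<^esub> L \<boxtimes>\<^bsub>K\<^esub> M2\<^esub> ?f2 ?t2"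
      let ?v1 = "?f1 ?s1 \<ominus>\<^bsub>L \<boxtimes>\<^bsub>K\<^esub> L \<boxtimes>\<^bsub>K\<^esub> M1\<^esub> ?s1" and ?v2 = "?f2 ?s2 \<ominus>\<^bsub>L \<boxtimes>\<^bsub>K\<^esub> L \<boxtimes>\<^bsub>K\<^esub> M2\<^esub> ?s2"
      note p = linear_map_compose[OF app'(1)[OF closed(3)[OF closed(3)[OF mn(2)]]] leg1']
      note q = linear_map_compose[OF ins'(1)[OF closed(2)[OF closed(2)[OF mn(1)]]] leg2']
      interpret Z1: vectorspace K "L \<boxtimes>\<^bsub>K\<^esub> L \<boxtimes>\<^bsub>K\<^esub> M1" by (intro tensor_space_vectorspace vs)
      interpret Z2: vectorspace K "L \<boxtimes>\<^bsub>K\<^esub> L \<boxtimes>\<^bsub>K\<^esub> M2" by (intro tensor_space_vectorspace vs)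
      note Bm = linear_mapD(3)[OF C1.B_linear mn(1)] linear_mapD(3)[OF C2.B_linear mn(2)]
      have c: "?t1 \<in> carrier (L \<boxtimes>\<^bsub>K\<^esub> L \<boxtimes>\<^bsub>K\<^esub> M1)" "?s1 \<in> carrier (L \<boxtimes>\<^bsub>K\<^esub> L \<boxtimes>\<^bsub>K\<^esub> M1)"
        "?t2 \<in> carrier (L \<boxtimes>\<^bsub>K\<^esub> L \<boxtimes>\<^bsub>K\<^esub> M2)" "?s2 \<in> carrier (L \<boxtimes>\<^bsub>K\<^esub> L \<boxtimes>\<^bsub>K\<^esub> M2)"
        by (rule linear_mapD(3)[OF tensor_map(1)[OF a C1.B_linear] Bm(1)]
            linear_mapD(3)[OF linear_map_compose[OF as1 tensor_map(1)[OF L.Delta_linear a1]] Bm(1)]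
            linear_mapD(3)[OF tensor_map(1)[OF a C2.B_linear] Bm(2)]
            linear_mapD(3)[OF linear_map_compose[OF as2 tensor_map(1)[OF L.Delta_linear a2]] Bm(2)])+
      note f = linear_mapD(3)[OF fl1 c(1)] linear_mapD(3)[OF fl1 c(2)]
        linear_mapD(3)[OF fl2 c(3)] linear_mapD(3)[OF fl2 c(4)]
      note pq = linear_mapD(3)[OF p c(2)] linear_mapD(3)[OF q c(4)]
        linear_mapD(3)[OF p f(2)] linear_mapD(3)[OF q f(4)]
      have uv: "?u1 \<in> carrier (L \<boxtimes>\<^bsub>K\<^esub> L \<boxtimes>\<^bsub>K\<^esub> M1)" "?v1 \<in> carrier (L \<boxtimes>\<^bsub>K\<^esub> L \<boxtimes>\<^bsub>K\<^esub> M1)"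
        "?u2 \<in> carrier (L \<boxtimes>\<^bsub>K\<^esub> L \<boxtimes>\<^bsub>K\<^esub> M2)" "?v2 \<in> carrier (L \<boxtimes>\<^bsub>K\<^esub> L \<boxtimes>\<^bsub>K\<^esub> M2)"
        using c f by simp_all
      note UV = linear_mapD(3)[OF p uv(1)] linear_mapD(3)[OF p uv(2)]
        linear_mapD(3)[OF q uv(3)] linear_mapD(3)[OF q uv(4)]
      have BB: "?BB ?t \<ominus>\<^bsub>?Z\<^esub> flip (?BB ?t) = ?p ?u1 \<oplus>\<^bsub>?Z\<^esub> ?q ?u2"
        by (rule map_co_co_minus[OF C1.B_linear C2.B_linear B1a B2a C1.B_linear C2.B_linear B1a B2a mn])
      \<comment> \<open>Since \<open>?s\<close> has no mixed part, the flip passes through its two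
        summands separately.\<close>
      have "flip (?s ?t) = ?p (?f1 ?s1) \<oplus>\<^bsub>?Z\<^esub> ?q (?f2 ?s2)"
        using pq by (simp add: dco[OF _ C1.B_linear C2.B_linear mn] linear_mapD(4)[OF flip(1)]
            flip_app' flip_ins' closed mn c)
      then have ss: "flip (?s ?t) \<ominus>\<^bsub>?Z\<^esub> ?s ?t = ?p ?v1 \<oplus>\<^bsub>?Z\<^esub> ?q ?v2"
        using pq by (simp add: dco[OF _ C1.B_linear C2.B_linear mn] Z.M.minus_add_minus
            linear_mapD(5)[OF p f(2) c(2)] linear_mapD(5)[OF q f(4) c(4)])
      \<comment> \<open>Axiom (d) over \<open>M1\<close> and \<open>M2\<close> enters here. What
        remains is to regroup by kind of difference (\<open>?u\<close> or \<open>?v\<close>) instead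
        of by factor.\<close>
      have "tensor_assoc_right K L L M (tensor_map K L (L \<boxtimes>\<^bsub>K\<^esub> L) M M \<gamma> aM (co B1 B2 ?t))
        = ?p (?u1 \<oplus>\<^bsub>L \<boxtimes>\<^bsub>K\<^esub> L \<boxtimes>\<^bsub>K\<^esub> M1\<^esub> ?v1) \<oplus>\<^bsub>?Z\<^esub> ?q (?u2 \<oplus>\<^bsub>L \<boxtimes>\<^bsub>K\<^esub> L \<boxtimes>\<^bsub>K\<^esub> M2\<^esub> ?v2)"
        using C1.gamma_B[OF mn(1)] C2.gamma_B[OF mn(2)]
        by (simp add: gco[OF _ C1.B_linear C2.B_linear mn] Let_def)
      also have "\<dots> = (?p ?u1 \<oplus>\<^bsub>?Z\<^esub> ?q ?u2) \<oplus>\<^bsub>?Z\<^esub> (?p ?v1 \<oplus>\<^bsub>?Z\<^esub> ?q ?v2)"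
        unfolding linear_mapD(4)[OF p uv(1,2)] linear_mapD(4)[OF q uv(3,4)]
        using UV by (simp add: Z.M.a_ac)
      finally show "tensor_assoc_right K L L M (tensor_map K L (L \<boxtimes>\<^bsub>K\<^esub> L) M M \<gamma> aM (co B1 B2 ?t))
        = (?BB ?t \<ominus>\<^bsub>?Z\<^esub> flip (?BB ?t)) \<oplus>\<^bsub>?Z\<^esub> (flip (?s ?t) \<ominus>\<^bsub>?Z\<^esub> ?s ?t)"
        unfolding BB ss .
    qed
    then show "(tensor_assoc_right K L L M \<circ> tensor_map K L (L \<boxtimes>\<^bsub>K\<^esub> L) M M \<gamma> aM \<circ> co B1 B2) t
      = (let t' = (tensor_map K L L M (L \<boxtimes>\<^bsub>K\<^esub> M) \<alpha> (co B1 B2) \<circ> co B1 B2) t;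
             s = (tensor_assoc_right K L L M \<circ> tensor_map K L (L \<boxtimes>\<^bsub>K\<^esub> L) M M \<Delta> aM \<circ> co B1 B2) t
         in (t' \<ominus>\<^bsub>?Z\<^esub> flip t') \<oplus>\<^bsub>?Z\<^esub> (flip s \<ominus>\<^bsub>?Z\<^esub> s))"
      by (simp add: Let_def)
  qed
qed

end
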